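(* Let $(A,\Phi)\in\mathbf{AP}$ satisfy $\inf_{q\in\Lambda}\mathcal I(q)<0$. Then there exists a non-constant $\mathbf q\in\mathcal K_\Lambda$ such that $\mathcal I(\mathbf q)=\min_{q\in\Lambda}\mathcal I(q)$.
   Context: Fix $T>0$ and a compact $\mathcal S\subset\mathbb R^3$ (possibly empty), $\mathcal S^c=\mathbb R^3\setminus\mathcal S$. $\mathcal A$ is the set of $A\in\mathcal C^1(\mathbb R^4;\mathbb R^3)$, $A=A(t,x)$, $T$-periodic in $t$, with $\partial_tA\not\equiv0$ and $\lim_{|x|\to\infty}(|\partial_tA|+|\nabla A|)=0$ uniformly in $t$ ($\nabla$ = spatial derivative). $\mathcal P$ is the set of $\Phi:\mathbb R\times\mathcal S^c\to\mathbb R$ bounded above, $T$-periodic and continuous in $t$, $\Phi(t,\cdot)\in\mathcal C^1(\mathcal S^c)$, $\lim_{|x|\to\infty}|\nabla\Phi(t,x)|=0$ uniformly in $t$, and, if $\mathcal S\ne\emptyset$, for each $x_0\in\partial\mathcal S$, $t_0\in[0,T]$ there are $\varepsilon,r>0$ with $-\Phi(t,x)\ge r/|x-x_0|$ whenever $|x-x_0|,|t-t_0|<\varepsilon$, $x\in\mathcal S^c$. $\varphi(x)=\int_0^T\Phi(t,x)dt$, normalized so that $\sup_{\mathcal S^c}\varphi=0$. $\mathbf{AP}$ = pairs $(A,\Phi)\in\mathcal A\times\mathcal P$ with $\partial_tA+\nabla\Phi\not\equiv0$. $\mathcal W$ = Lipschitz $T$-periodic $q:\mathbb R\to\mathbb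 R^3$ with norm $\|q\|_\infty+\|\dot q\|_\infty$; $\mathcal K=\{q\in\mathcal W:\|\dot q\|_\infty\le1\}$; $\Lambda=\{q\in\mathcal W: q(t)\notin\mathcal S\ \forall t\}$; $\mathcal K_\Lambda=\mathcal K\cap\Lambda$. $\mathcal I(q)=\int_0^T(1-\sqrt{1-|\dot q|^2})dt+\int_0^T(\dot q\cdot A(t,q)-\Phi(t,q))dt$ for $q\in\mathcal K_\Lambda$ and $\mathcal I(q)=+\infty$ for $q\in\Lambda\setminus\mathcal K_\Lambda$. *)

theory Defs
  imports "HOL-Analysis.Analysis"
begin

type_synonym vec3 = "real ^ 3"

definition dtA :: "(real \<Rightarrow> vec3 \<Rightarrow> vec3) \<Rightarrow> real \<Rightarrow> vec3 \<Rightarrow> vec3" where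
  "dtA A t x = vector_derivative (\<lambda>s. A s x) (at t)"

definition gradA :: "(real \<Rightarrow> vec3 \<Rightarrow> vec3) \<Rightarrow> real \<Rightarrow> vec3 \<Rightarrow> vec3 \<Rightarrow> vec3" where
  "gradA A t x = frechet_derivative (A t) (at x)"

definition gradPhi :: "(real \<Rightarrow> vec3 \<Rightarrow> real) \<Rightarrow> real \<Rightarrow> vec3 \<Rightarrow> vec3" where
  "gradPhi P t x = (THE g. (P t has_derivative (\<lambda>h. g \<bullet> h)) (at x))"

definition C1_R4 :: "(real \<Rightarrow> vec3 \<Rightarrow> vec3) \<Rightarrow> bool" where
  "C1_R4 A \<longleftrightarrow> (\<exists>D :: real \<times> vec3 \<Rightarrow> (real \<times> vec3) \<Rightarrow>\<^sub>L vec3.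
      (\<forall>z. ((\<lambda>p. A (fst p) (snd p)) has_derivative blinfun_apply (D z)) (at z))
      \<and> continuous_on UNIV D)"

definition classA :: "real \<Rightarrow> (real \<Rightarrow> vec3 \<Rightarrow> vec3) \<Rightarrow> bool" where
  "classA T A \<longleftrightarrow> C1_R4 A
     \<and> (\<forall>t x. A (t + T) x = A t x)
     \<and> (\<exists>t x. dtA A t x \<noteq> 0)
     \<and> (\<forall>e>0. \<exists>R. \<forall>t x. R \<le> norm x \<longrightarrow>
           norm (dtA A t x) + onorm (gradA A t x) < e)"

definition classP :: "real \<Rightarrow> vec3 set \<Rightarrow> (real \<Rightarrow> vec3 \<Rightarrow> real) \<Rightarrow> bool" where
  "classP T S P \<longleftrightarrow>
       (\<exists>M. \<forall>t. \<forall>x. x \<notin> S \<longrightarrow> P t x \<le> M)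
     \<and> (\<forall>t x. x \<notin> S \<longrightarrow> P (t + T) x = P t x)
     \<and> (\<forall>x. x \<notin> S \<longrightarrow> continuous_on UNIV (\<lambda>t. P t x))
     \<and> (\<forall>t. (\<forall>x. x \<notin> S \<longrightarrow> P t differentiable (at x))
            \<and> continuous_on (- S) (gradPhi P t))
     \<and> (\<forall>e>0. \<exists>R. \<forall>t x. x \<notin> S \<and> R \<le> norm x \<longrightarrow> norm (gradPhi P t x) < e)
     \<and> (S \<noteq> {} \<longrightarrow> (\<forall>x0\<in>frontier S. \<forall>t0\<in>{0..T}. \<exists>\<epsilon>>0. \<exists>r>0.
            \<forall>t x. x \<notin> S \<and> dist x x0 < \<epsilon> \<and> \<bar>t - t0\<bar> < \<epsilon> \<longrightarrow>
                  - P t x \<ge> r / norm (x - x0)))"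

definition varphi :: "real \<Rightarrow> (real \<Rightarrow> vec3 \<Rightarrow> real) \<Rightarrow> vec3 \<Rightarrow> real" where
  "varphi T P x = integral {0..T} (\<lambda>t. P t x)"

definition normalized :: "real \<Rightarrow> vec3 set \<Rightarrow> (real \<Rightarrow> vec3 \<Rightarrow> real) \<Rightarrow> bool" where
  "normalized T S P \<longleftrightarrow> Sup (varphi T P ` (- S)) = 0"

definition classAP :: "real \<Rightarrow> vec3 set \<Rightarrow> (real \<Rightarrow> vec3 \<Rightarrow> vec3) \<Rightarrow> (real \<Rightarrow> vec3 \<Rightarrow> real) \<Rightarrow> bool" where
  "classAP T S A P \<longleftrightarrow> classA T A \<and> classP T S P \<and> normalized T S P
     \<and> (\<exists>t x. x \<notin> S \<and> dtA A t x + gradPhi P t x \<noteq> 0)"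

text \<open>W: Lipschitz T-periodic loops; K: those with ess-sup of |q'| at most 1, i.e. 1-Lipschitz.\<close>
definition Wsp :: "real \<Rightarrow> (real \<Rightarrow> vec3) set" where
  "Wsp T = {q. (\<exists>L. L-lipschitz_on UNIV q) \<and> (\<forall>t. q (t + T) = q t)}"

definition Ksp :: "real \<Rightarrow> (real \<Rightarrow> vec3) set" where
  "Ksp T = {q \<in> Wsp T. 1-lipschitz_on UNIV q}"

definition Lam :: "real \<Rightarrow> vec3 set \<Rightarrow> (real \<Rightarrow> vec3) set" where
  "Lam T S = {q \<in> Wsp T. \<forall>t. q t \<notin> S}"

definition KLam :: "real \<Rightarrow> vec3 set \<Rightarrow> (real \<Rightarrow> vec3) set" where
  "KLam T S = Ksp T \<inter> Lam T S"

definition Ifun :: "real \<Rightarrow> vec3 set \<Rightarrow> (real \<Rightarrow> vec3 \<Rightarrow> vec3) \<Rightarrow> (real \<Rightarrow> vec3 \<Rightarrow> real)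
                    \<Rightarrow> (real \<Rightarrow> vec3) \<Rightarrow> ereal" where
  "Ifun T S A P q =
     (if q \<in> KLam T S then
        ereal (integral {0..T} (\<lambda>t. 1 - sqrt (1 - (norm (vector_derivative q (at t)))\<^sup>2))
             + integral {0..T} (\<lambda>t. vector_derivative q (at t) \<bullet> A t (q t) - P t (q t)))
      else \<infinity>)"

end

(*
The minimum is found by the direct method. A minimising sequence q_n of
1-Lipschitz loops cannot escape to infinity: there A is nearly constant along q_n and
the integral of q_n' vanishes, so the action is at least -phi(q_n(0)) - o(1) >= - o(1),
whereas the infimum is negative. By Arzela-Ascoli q_n -> p along a subsequence. The limit avoids S since
-P >= r/|x - x0| near x0 in the boundary of S and a unit-speed path stays near x0
long enough to make the integral of -P diverge logarithmically.

For lower semicontinuity put sigma_n(t) = int_0^t sqrt(1 - |q_n'|^2). Since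
(sqrt(1 - |q_n'|^2), q_n') is a unit vector, the path (sigma_n, q_n) is
1-Lipschitz in R x R^3, hence so is every limit (sigma, p); therefore
sigma' <= sqrt(1 - |p'|^2) almost everywhere. The magnetic
term is continuous along a subsequence, and the potential term is handled by Fatou's lemma.
Constant loops have action -phi >= 0, so a minimiser of negative action is not constant.

Lipschitz paths are almost everywhere differentiable and satisfy the fundamental theorem
of calculus: adding a linear term makes a real Lipschitz function a bi-Lipschitz
homeomorphism, the Radon-Nikodym theorem represents it as an indefinite integral, and
the Henstock lemma with a Vitali covering differentiates that integral.
*)
theory Submission
  imports Defs "HOL-Complex_Analysis.Great_Picard"
begin

subsection \<open>Differentiation of indefinite integrals\<close>

text \<open>By the Henstock lemma the errors over any sufficiently fine partial tagged division sum
  to less than \<open>e * \<delta>\<close>. A Vitali selection of disjoint bad intervals has such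
  divisions as its finite parts. Each interval contributes more than \<open>\<delta>\<close> times
  its length, so the selection, which covers the set up to a null set, has measure at most
  \<open>e\<close>.\<close>

lemma negligible_large_averaging_error:
  fixes h :: "real \<Rightarrow> real"
  assumes h: "h integrable_on {a..b}" and "\<delta> > 0"
  shows "negligible {x. \<forall>d>0. \<exists>u v. a \<le> u \<and> u < v \<and> v \<le> b \<and> v - u < d \<and> x \<in> {u..v}
            \<and> \<bar>(v - u) * h x - integral {u..v} h\<bar> > \<delta> * (v - u)}" (is "negligible ?E")
proof (rule negligible_outer_le[THEN iffD2], intro allI impI)
  fix e :: real assume "e > 0"
  then have "e * \<delta> > 0" using \<open>\<delta> > 0\<close> by simp
  from h have "h integrable_on cbox a b" by simp
  then obtain \<gamma> where \<gamma>: "gauge \<gamma>" and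
    hen: "\<And>p. \<lbrakk>p tagged_partial_division_of (cbox a b); \<gamma> fine p\<rbrakk> \<Longrightarrow>
             sum (\<lambda>(x,k). norm(measure lborel k *\<^sub>R h x - integral k h)) p < e * \<delta>"
    by (rule Henstock_lemma[OF _ \<open>e * \<delta> > 0\<close>]) blast
  \<comment> \<open>\<open>K\<close> indexes the tagged bad intervals that are fine for the gauge.
    Centres \<open>c\<close> and radii \<open>r\<close> present them as closed balls, the form in
    which the covering theorem applies.\<close>
  define K where "K = {(x,u,v). a \<le> u \<and> u < v \<and> v \<le> b \<and> x \<in> {u..v} \<and> {u..v} \<subseteq> \<gamma> x
     \<and> \<bar>(v - u) * h x - integral {u..v} h\<bar> > \<delta> * (v - u)}"
  define c where "c = (\<lambda>(x::real,u::real,v::real). (u + v) / 2)"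
  define r where "r = (\<lambda>(x::real,u::real,v::real). (v - u) / 2)"
  define I where "I = (\<lambda>(x::real,u::real,v::real). {u..v})"
  have cb: "cball (c i) (r i) = I i" for i
    unfolding c_def r_def I_def split_beta cball_eq_atLeastAtMost by (simp add: field_simps)
  have rpos: "0 < r i" if "i \<in> K" for i
    using that by (auto simp: K_def r_def)
  have vit: "\<exists>i. i \<in> K \<and> x \<in> cball (c i) (r i) \<and> r i < d" if "x \<in> ?E" "0 < d" for x d
  proof -
    have "open (\<gamma> x)" "x \<in> \<gamma> x" using \<gamma> by (auto simp: gauge_def)
    then obtain \<eta> where \<eta>: "\<eta> > 0" "ball x \<eta> \<subseteq> \<gamma> x" by (meson open_contains_ball)
    then have "min \<eta> d > 0" using \<open>d > 0\<close> by simp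
    with that(1) obtain u v where uv: "a \<le> u" "u < v" "v \<le> b" "v - u < min \<eta> d" "x \<in> {u..v}"
      "\<bar>(v - u) * h x - integral {u..v} h\<bar> > \<delta> * (v - u)" by blast
    have "{u..v} \<subseteq> ball x \<eta>" using uv by (auto simp: dist_real_def)
    then have "(x,u,v) \<in> K" using uv \<eta> by (auto simp: K_def)
    moreover have "x \<in> cball (c (x,u,v)) (r (x,u,v))" unfolding cb using uv by (simp add: I_def)
    moreover have "r (x,u,v) < d" using uv by (simp add: r_def)
    ultimately show ?thesis by blast
  qed
  obtain C where C: "countable C" "C \<subseteq> K"
     and disj: "pairwise (\<lambda>i j. disjnt (cball (c i) (r i)) (cball (c j) (r j))) C"
     and neg: "negligible(?E - (\<Union>i \<in> C. cball (c i) (r i)))"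
    by (rule Vitali_covering_theorem_cballs[of K r ?E c, OF rpos vit])
  \<comment> \<open>Only finite subfamilies are partial divisions. The bound does not depend on
    \<open>F\<close>, so it passes to the union over the countable family \<open>C\<close>.\<close>
  have bound: "measure lebesgue (\<Union>i\<in>F. I i) \<le> e" if F: "F \<subseteq> C" "finite F" for F
  proof -
    define p where "p = (\<lambda>i. (fst i, I i)) ` F"
    have FK: "F \<subseteq> K" using F C by auto
    have dj: "I i \<inter> I j = {}" if "i \<in> F" "j \<in> F" "i \<noteq> j" for i j
      using disj that F unfolding cb pairwise_def disjnt_def by blast
    have ne: "I i \<noteq> {}" if "i \<in> F" for i
      using that FK by (force simp: K_def I_def)
    \<comment> \<open>Disjoint nonempty intervals are distinct, so no two indices give the same
      tagged interval and the sum over \<open>p\<close> can be reindexed over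
      \<open>F\<close>.\<close>
    have inj: "inj_on (\<lambda>i. (fst i, I i)) F"
      unfolding inj_on_def using dj ne by (metis inf.idem prod.inject)
    have tp: "p tagged_partial_division_of (cbox a b)"
      unfolding tagged_partial_division_of_def
    proof (intro conjI allI impI)
      show "finite p" using F by (simp add: p_def)
      fix x k assume "(x, k) \<in> p"
      then obtain i where i: "i \<in> F" "x = fst i" "k = I i" by (auto simp: p_def)
      obtain y u v where yuv: "i = (y, u, v)" by (cases i)
      have "i \<in> K" using i FK by auto
      then have "x \<in> {u..v}" "a \<le> u" "v \<le> b" using i yuv by (auto simp: K_def)
      moreover have "k = {u..v}" using i yuv by (simp add: I_def)
      ultimately show "x \<in> k" "k \<subseteq> cbox a b" "\<exists>a b. k = cbox a b"
        by (simp, simp, metis box_real(2))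
    next
      fix x k x' k' assume "(x, k) \<in> p \<and> (x', k') \<in> p \<and> (x, k) \<noteq> (x', k')"
      then obtain i j where "i \<in> F" "k = I i" "j \<in> F" "k' = I j" "i \<noteq> j"
        unfolding p_def by blast
      then have "k \<inter> k' = {}" using dj by auto
      then show "interior k \<inter> interior k' = {}"
        using interior_subset by blast
    qed
    have fine: "\<gamma> fine p"
    proof (rule fineI)
      fix x k assume "(x, k) \<in> p"
      then obtain i where "i \<in> F" "x = fst i" "k = I i" unfolding p_def by blast
      moreover have "I i \<subseteq> \<gamma> (fst i)" if "i \<in> K" for i using that by (auto simp: K_def I_def)
      ultimately show "k \<subseteq> \<gamma> x" using FK by blast
    qed
    have "(\<Sum>i\<in>F. \<delta> * measure lebesgue (I i)) \<le> (\<Sum>i\<in>F. norm (measure lborel (I i) *\<^sub>R h (fst i) - integral (I i) h))"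
    proof (rule sum_mono)
      fix i assume "i \<in> F"
      then have "i \<in> K" using FK by blast
      then show "\<delta> * measure lebesgue (I i) \<le> norm (measure lborel (I i) *\<^sub>R h (fst i) - integral (I i) h)"
        by (auto simp: K_def I_def)
    qed
    also have "\<dots> = sum (\<lambda>(x,k). norm(measure lborel k *\<^sub>R h x - integral k h)) p"
      unfolding p_def by (simp add: sum.reindex[OF inj])
    also have "\<dots> < e * \<delta>" by (rule hen[OF tp fine])
    finally have "\<delta> * (\<Sum>i\<in>F. measure lebesgue (I i)) < \<delta> * e" by (simp add: sum_distrib_left mult.commute)
    then have "(\<Sum>i\<in>F. measure lebesgue (I i)) < e" using \<open>\<delta> > 0\<close> by simp
    moreover have "measure lebesgue (\<Union>i\<in>F. I i) \<le> (\<Sum>i\<in>F. measure lebesgue (I i))"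
      by (rule measure_UNION_le) (use F in \<open>auto simp: I_def\<close>)
    ultimately show ?thesis by linarith
  qed
  have Im: "I i \<in> lmeasurable" for i by (auto simp: I_def split_beta)
  have U: "(\<Union>i\<in>C. I i) \<in> lmeasurable" "measure lebesgue (\<Union>i\<in>C. I i) \<le> e"
    using fmeasurable_UN_bound[OF C(1) Im bound] measure_UN_bound[OF C(1) Im bound] by blast+
  let ?N = "?E - (\<Union>i \<in> C. I i)"
  have N: "negligible ?N" using neg unfolding cb .
  show "\<exists>T. ?E \<subseteq> T \<and> T \<in> lmeasurable \<and> measure lebesgue T \<le> e"
  proof (intro exI conjI)
    show "?E \<subseteq> (\<Union>i\<in>C. I i) \<union> ?N" by blast
    show "(\<Union>i\<in>C. I i) \<union> ?N \<in> lmeasurable"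
      by (rule fmeasurable.Un[OF U(1) negligible_imp_measurable[OF N]])
    show "measure lebesgue ((\<Union>i\<in>C. I i) \<union> ?N) \<le> e"
      using measure_Un_le[OF fmeasurableD[OF U(1)] negligible_imp_sets[OF N]] U(2)
        negligible_imp_measure0[OF N] by linarith
  qed
qed

text \<open>The exceptional set is the union of the bad sets for the thresholds 1, 1/2, 1/3 and so
  on. The bad intervals may have the point as an endpoint, so left and right difference quotients
  are both controlled.\<close>

lemma Lebesgue_differentiation_interval:
  fixes h :: "real \<Rightarrow> real"
  assumes h: "h integrable_on {a..b}"
  obtains N where "negligible N"
    "\<And>x. \<lbrakk>a < x; x < b; x \<notin> N\<rbrakk> \<Longrightarrow> ((\<lambda>x. integral {a..x} h) has_real_derivative h x) (at x)"
proof -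
  define E where "E = (\<lambda>\<delta>. {x. \<forall>d>0. \<exists>u v. a \<le> u \<and> u < v \<and> v \<le> b \<and> v - u < d \<and> x \<in> {u..v}
            \<and> \<bar>(v - u) * h x - integral {u..v} h\<bar> > \<delta> * (v - u)})"
  define N where "N = (\<Union>n::nat. E (1 / real (Suc n)))"
  have "negligible N" unfolding N_def E_def
    by (rule negligible_Union_nat, rule negligible_large_averaging_error[OF h]) simp
  moreover have "((\<lambda>x. integral {a..x} h) has_real_derivative h x) (at x)"
    if x: "a < x" "x < b" "x \<notin> N" for x
  proof -
    let ?H = "\<lambda>x. integral {a..x} h"
    have diff: "integral {u..v} h = ?H v - ?H u" if "a \<le> u" "u \<le> v" "v \<le> b" for u v
      using Henstock_Kurzweil_Integration.integral_combine[of a u v h] that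
        integrable_on_subinterval[OF h, of a v] by auto
    show ?thesis unfolding has_field_derivative_iff tendsto_iff
    proof (intro allI impI)
      fix e :: real assume "e > 0"
      obtain n where n: "1 / real (Suc n) < e" using \<open>e > 0\<close> nat_approx_posE by blast
      have "x \<notin> E (1 / real (Suc n))" using x by (auto simp: N_def)
      then obtain d where d: "d > 0" and *: "\<And>u v. \<lbrakk>a \<le> u; u < v; v \<le> b; v - u < d; x \<in> {u..v}\<rbrakk>
            \<Longrightarrow> \<bar>(v - u) * h x - integral {u..v} h\<bar> \<le> 1 / real (Suc n) * (v - u)"
        unfolding E_def mem_Collect_eq by (metis not_less)
      have "dist ((?H y - ?H x) / (y - x)) (h x) < e"
        if y: "y \<noteq> x" "dist y x < Min {d, x - a, b - x}" for y
      proof -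
        have b: "\<bar>(y - x) * h x - (?H y - ?H x)\<bar> \<le> 1 / real (Suc n) * \<bar>y - x\<bar>"
        proof (cases "x < y")
          case True
          then show ?thesis using *[of x y] diff[of x y] x y by (auto simp: dist_real_def)
        next
          case False
          then have "y < x" using y by auto
          then have "\<bar>(x - y) * h x - (?H x - ?H y)\<bar> \<le> 1 / real (Suc n) * (x - y)"
            using *[of y x] diff[of y x] x y by (auto simp: dist_real_def)
          moreover have "(x - y) * h x - (?H x - ?H y) = - ((y - x) * h x - (?H y - ?H x))"
            by (simp add: algebra_simps)
          ultimately show ?thesis using \<open>y < x\<close> by simp
        qed
        have "(?H y - ?H x) / (y - x) - h x = - (((y - x) * h x - (?H y - ?H x)) / (y - x))"
          using y by (simp add: field_simps)
        then have "dist ((?H y - ?H x) / (y - x)) (h x) = \<bar>(y - x) * h x - (?H y - ?H x)\<bar> / \<bar>y - x\<bar>"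
          by (simp add: dist_real_def abs_divide)
        also have "\<dots> \<le> 1 / real (Suc n)" using b y by (simp add: divide_le_eq)
        finally show ?thesis using n by simp
      qed
      then show "\<forall>\<^sub>F y in at x. dist ((?H y - ?H x) / (y - x)) (h x) < e"
        unfolding eventually_at using d x by (intro exI[of _ "Min {d, x - a, b - x}"]) auto
    qed
  qed
  ultimately show thesis using that by blast
qed

subsection \<open>Lipschitz paths\<close>

lemma lipschitz_real_has_density:
  fixes f :: "real \<Rightarrow> real"
  assumes f: "C-lipschitz_on UNIV f"
  obtains h where "\<And>u v. u \<le> v \<Longrightarrow> (h has_integral (f v - f u)) {u..v}"
proof -
  have "C \<ge> 0" using f lipschitz_on_nonneg by blast
  have fl: "\<bar>f y - f x\<bar> \<le> C * \<bar>y - x\<bar>" for x y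
    using lipschitz_onD[OF f, of y x] by (simp add: dist_real_def)
  \<comment> \<open>Slope \<open>C + 1\<close> instead of \<open>C\<close> makes \<open>F\<close>
    expand distances by a factor of at least 1, so that its inverse \<open>H\<close> is
    1-Lipschitz.\<close>
  define F where "F = (\<lambda>x. f x + (C + 1) * x)"
  have F_ge: "y - x \<le> F y - F x" if "x \<le> y" for x y
    using fl[of y x] that by (simp add: F_def algebra_simps)
  have F_le: "\<bar>F y - F x\<bar> \<le> (2 * C + 1) * \<bar>y - x\<bar>" for x y
  proof -
    have "F y - F x = (f y - f x) + (C + 1) * (y - x)" by (simp add: F_def algebra_simps)
    then have "\<bar>F y - F x\<bar> \<le> \<bar>f y - f x\<bar> + \<bar>(C + 1) * (y - x)\<bar>" by linarith
    moreover have "\<bar>(C + 1) * (y - x)\<bar> = C * \<bar>y - x\<bar> + \<bar>y - x\<bar>"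
      using \<open>C \<ge> 0\<close> unfolding abs_mult by (simp add: distrib_right)
    ultimately show ?thesis using fl[of y x] by (simp add: distrib_right)
  qed
  have contF: "continuous_on UNIV F"
    using f unfolding F_def by (intro continuous_intros) (rule lipschitz_on_continuous_on)
  have F_le_iff: "F x \<le> F y \<longleftrightarrow> x \<le> y" for x y
    using F_ge[of x y] F_ge[of y x] by (cases "x \<le> y"; force)
  have "inj F" by (rule injI) (metis F_le_iff order_antisym order_refl)
  have "surj F"
  proof -
    have "\<exists>x. F x = y" for y
    proof -
      let ?m = "\<bar>y\<bar> + \<bar>F 0\<bar>"
      have "F (- ?m) \<le> y" using F_ge[of "- ?m" 0] by linarith
      moreover have "y \<le> F ?m" using F_ge[of 0 ?m] by linarith
      moreover have "continuous_on {- ?m.. ?m} F" using contF continuous_on_subset by blast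
      ultimately show ?thesis using IVT'[of F "- ?m" y ?m] by auto
    qed
    then show ?thesis by (metis surjI)
  qed
  define H where "H = inv F"
  have FH: "F (H y) = y" for y using \<open>surj F\<close> by (simp add: H_def surj_f_inv_f)
  have HF: "H (F x) = x" for x using \<open>inj F\<close> by (simp add: H_def)
  have "1-lipschitz_on UNIV H"
  proof (rule lipschitz_onI)
    fix x y
    show "dist (H x) (H y) \<le> 1 * dist x y"
      using F_ge[of "H x" "H y"] F_ge[of "H y" "H x"]
      by (cases "H x \<le> H y") (auto simp: dist_real_def FH)
  qed simp
  then have "continuous_on UNIV H" by (rule lipschitz_on_continuous_on)
  then have Hm[measurable]: "H \<in> borel_measurable borel" by (rule borel_measurable_continuous_onI)
  have vim: "H -` B = F ` B" for B by (force simp: HF intro: FH[symmetric])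
  \<comment> \<open>This is the Stieltjes measure of \<open>F\<close>: the preimage of
    \<open>{u..v}\<close> under \<open>H\<close> is \<open>{F u..F v}\<close>. It is absolutely
    continuous because that preimage is in general an image under \<open>F\<close>, and Lipschitz
    maps preserve null sets.\<close>
  define \<mu> where "\<mu> = distr lborel borel H"
  have ac: "absolutely_continuous lborel \<mu>"
    unfolding absolutely_continuous_def
  proof
    fix B :: "real set" assume B: "B \<in> null_sets lborel"
    then have Bb: "B \<in> sets borel" by auto
    then have "B \<in> null_sets lebesgue" using B by (simp add: null_sets_completion_iff)
    then have "negligible B" by (simp add: negligible_iff_null_sets)
    then have "negligible (F ` B)"
    proof (rule negligible_locally_Lipschitz_image[rotated])
      show "\<exists>T B'. open T \<and> x \<in> T \<and> (\<forall>y\<in>B \<inter> T. norm (F y - F x) \<le> B' * norm (y - x))" for x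
        using F_le by (intro exI[of _ UNIV] exI[of _ "2 * C + 1"]) auto
    qed simp
    then have "H -` B \<in> null_sets lebesgue" by (simp add: negligible_iff_null_sets vim)
    moreover have "H -` B \<in> sets lborel" using measurable_sets[OF Hm Bb] by simp
    ultimately have "H -` B \<in> null_sets lborel" by (simp add: null_sets_completion_iff)
    then show "B \<in> null_sets \<mu>" using Bb by (simp add: \<mu>_def null_sets_distr_iff)
  qed
  obtain g where g[measurable]: "g \<in> borel_measurable lborel" and dens: "density lborel g = \<mu>"
    using sigma_finite_measure.Radon_Nikodym[OF lborel.sigma_finite_measure_axioms ac] by (auto simp: \<mu>_def)
  have gint: "(\<integral>\<^sup>+x. g x * indicator {u..v} x \<partial>lborel) = ennreal (F v - F u)" if "u \<le> v" for u v
  proof -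
    have "(\<integral>\<^sup>+x. g x * indicator {u..v} x \<partial>lborel) = emeasure \<mu> {u..v}"
      using emeasure_density[of g lborel "{u..v}"] by (simp add: dens[symmetric])
    also have "\<dots> = emeasure lborel (H -` {u..v})"
      unfolding \<mu>_def by (subst emeasure_distr) auto
    also have "H -` {u..v} = {F u..F v}"
    proof (rule set_eqI)
      fix y show "y \<in> H -` {u..v} \<longleftrightarrow> y \<in> {F u..F v}"
        using F_le_iff[of u "H y"] F_le_iff[of "H y" v] by (simp add: FH)
    qed
    finally show ?thesis using F_le_iff[of u v] that by simp
  qed
  \<comment> \<open>The density \<open>g\<close> has values in the extended nonnegative reals. Its
    integral over each compact interval is finite, so it is finite almost everywhere there and
    \<open>enn2real\<close> changes it only on a null set.\<close>
  define h where "h = (\<lambda>x. enn2real (g x))"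
  have hint: "(h has_integral (F v - F u)) {u..v}" if "u \<le> v" for u v
  proof -
    have "(\<integral>\<^sup>+x. g x * indicator {u..v} x \<partial>lborel) \<noteq> \<infinity>" using gint[OF that] by simp
    then have fin: "AE x in lborel. g x * indicator {u..v} x \<noteq> \<infinity>"
      by (intro nn_integral_noteq_infinite) measurable
    have "(\<integral>\<^sup>+x. ennreal (h x * indicator {u..v} x) \<partial>lborel) = (\<integral>\<^sup>+x. g x * indicator {u..v} x \<partial>lborel)"
    proof (rule nn_integral_cong_AE)
      show "AE x in lborel. ennreal (h x * indicator {u..v} x) = g x * indicator {u..v} x"
        using fin by eventually_elim (auto simp: h_def indicator_def top.not_eq_extremum)
    qed
    then have "((\<lambda>x. h x * indicator {u..v} x) has_integral (F v - F u)) UNIV"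
      using F_le_iff[of u v] that
      by (intro nn_integral_has_integral) (auto simp: h_def gint)
    moreover have "(\<lambda>x. h x * indicator {u..v} x) = (\<lambda>x. if x \<in> {u..v} then h x else 0)"
      by (auto simp: indicator_def)
    ultimately show ?thesis by (metis has_integral_restrict_UNIV)
  qed
  show thesis
  proof (rule that)
    fix u v :: real assume "u \<le> v"
    have "((\<lambda>x. h x - (C + 1)) has_integral ((F v - F u) - (v - u) * (C + 1))) {u..v}"
      using \<open>u \<le> v\<close> has_integral_const_real[of "C + 1" u v]
      by (intro has_integral_diff hint) auto
    then show "((\<lambda>x. h x - (C + 1)) has_integral (f v - f u)) {u..v}"
      by (simp add: F_def algebra_simps)
  qed
qed

text \<open>The density from the integral representation is also the derivative almost everywhere.
  Differentiation of integrals works on compact intervals, so it is applied on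
  \<open>{-n..n}\<close> for every \<open>n\<close> and the countably many exceptional sets are
  united.\<close>

lemma lipschitz_real_AE_derivative:
  fixes f :: "real \<Rightarrow> real"
  assumes f: "C-lipschitz_on UNIV f"
  obtains h N where "negligible N" "\<And>x. x \<notin> N \<Longrightarrow> (f has_real_derivative h x) (at x)"
    "\<And>u v. u \<le> v \<Longrightarrow> (h has_integral (f v - f u)) {u..v}"
proof -
  obtain h where h: "\<And>u v. u \<le> v \<Longrightarrow> (h has_integral (f v - f u)) {u..v}"
    using lipschitz_real_has_density[OF f] by blast
  have "\<exists>N. negligible N \<and> (\<forall>x. - a < x \<and> x < a \<and> x \<notin> N \<longrightarrow>
          ((\<lambda>x. integral {-a..x} h) has_real_derivative h x) (at x))" if "a \<ge> 0" for a :: real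
  proof -
    have "h integrable_on {-a..a}" using h[of "-a" a] that by auto
    from Lebesgue_differentiation_interval[OF this] show ?thesis by metis
  qed
  then have "\<forall>n::nat. \<exists>N. negligible N \<and> (\<forall>x. - real n < x \<and> x < real n \<and> x \<notin> N \<longrightarrow>
          ((\<lambda>x. integral {- real n..x} h) has_real_derivative h x) (at x))" by simp
  then obtain N where N: "\<And>n::nat. negligible (N n)"
    and d: "\<And>n x. \<lbrakk>- real n < x; x < real n; x \<notin> N n\<rbrakk> \<Longrightarrow>
          ((\<lambda>x. integral {- real n..x} h) has_real_derivative h x) (at x)" by metis
  show thesis
  proof (rule that)
    show "negligible (\<Union>n. N n)" using N by (rule negligible_Union_nat)
    fix x assume x: "x \<notin> (\<Union>n. N n)"
    obtain n where n: "\<bar>x\<bar> < real n" using reals_Archimedean2 by blast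
    have "((\<lambda>x. f (- real n) + integral {- real n..x} h) has_real_derivative h x) (at x)"
      using d[of n x] n x by (auto intro!: derivative_eq_intros)
    then show "(f has_real_derivative h x) (at x)"
    proof (rule DERIV_cong_ev[THEN iffD1, OF refl _ refl, rotated])
      show "\<forall>\<^sub>F y in nhds x. f (- real n) + integral {- real n..y} h = f y"
        unfolding eventually_nhds
      proof (intro exI[of _ "{- real n <..}"] conjI ballI)
        fix y assume "y \<in> {- real n <..}"
        then show "f (- real n) + integral {- real n..y} h = f y"
          using integral_unique[OF h[of "- real n" y]] by auto
      qed (use n in auto)
    qed
  qed (rule h)
qed

text \<open>The real case is applied to each coordinate. The result is phrased with
  \<open>vector_derivative\<close>, the form in which velocities enter the action; its unspecified
  values at the remaining points lie in a null set and do not affect the integrals.\<close>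

theorem lipschitz_AE_vector_derivative:
  fixes f :: "real \<Rightarrow> 'a::euclidean_space"
  assumes f: "C-lipschitz_on UNIV f"
  obtains N where "negligible N"
    "\<And>t. t \<notin> N \<Longrightarrow> (f has_vector_derivative vector_derivative f (at t)) (at t)"
    "\<And>a b. a \<le> b \<Longrightarrow> ((\<lambda>t. vector_derivative f (at t)) has_integral (f b - f a)) {a..b}"
proof -
  have "\<exists>h N. negligible N \<and> (\<forall>x. x \<notin> N \<longrightarrow> ((\<lambda>x. f x \<bullet> i) has_real_derivative h x) (at x))
    \<and> (\<forall>u v. u \<le> v \<longrightarrow> (h has_integral (f v \<bullet> i - f u \<bullet> i)) {u..v})" if "i \<in> Basis" for i
  proof -
    have "C-lipschitz_on UNIV (\<lambda>x. f x \<bullet> i)"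
    proof (rule lipschitz_onI)
      show "dist (f x \<bullet> i) (f y \<bullet> i) \<le> C * dist x y" for x y
        using lipschitz_onD[OF f, of x y] Basis_le_norm[OF that, of "f x - f y"]
        by (simp add: dist_norm inner_diff_left)
    qed (use f lipschitz_on_nonneg in blast)
    from lipschitz_real_AE_derivative[OF this] show ?thesis by metis
  qed
  then obtain h N where N: "\<And>i. i \<in> Basis \<Longrightarrow> negligible (N i)"
    and d: "\<And>i x. \<lbrakk>i \<in> Basis; x \<notin> N i\<rbrakk> \<Longrightarrow> ((\<lambda>x. f x \<bullet> i) has_real_derivative h i x) (at x)"
    and int: "\<And>i u v. \<lbrakk>i \<in> Basis; u \<le> v\<rbrakk> \<Longrightarrow> (h i has_integral (f v \<bullet> i - f u \<bullet> i)) {u..v}"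
    by metis
  define k where "k = (\<lambda>x. \<Sum>i\<in>Basis. h i x *\<^sub>R i)"
  have ki: "k x \<bullet> i = h i x" if "i \<in> Basis" for i x
    using that by (simp add: k_def inner_sum_left inner_Basis if_distrib cong: if_cong)
  let ?N = "\<Union>i\<in>Basis. N i"
  have neg: "negligible ?N" using N by (intro negligible_Union) auto
  have der: "(f has_vector_derivative k t) (at t)" if "t \<notin> ?N" for t
    unfolding has_vector_derivative_def
  proof (subst has_derivative_componentwise_within, intro ballI)
    fix i :: 'a assume i: "i \<in> Basis"
    have "((\<lambda>x. f x \<bullet> i) has_derivative (*) (h i t)) (at t)"
      using d[OF i, of t] that i by (auto simp: has_field_derivative_def)
    then show "((\<lambda>x. f x \<bullet> i) has_derivative (\<lambda>x. x *\<^sub>R k t \<bullet> i)) (at t)"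
      by (simp add: ki[OF i] mult.commute[of _ "h i t"])
  qed
  have eq: "vector_derivative f (at t) = k t" if "t \<notin> ?N" for t
    using der[OF that] by (rule vector_derivative_at)
  show thesis
  proof (rule that[OF neg])
    show "(f has_vector_derivative vector_derivative f (at t)) (at t)" if "t \<notin> ?N" for t
      using der[OF that] eq[OF that] by simp
    show "((\<lambda>t. vector_derivative f (at t)) has_integral (f b - f a)) {a..b}" if "a \<le> b" for a b
    proof (rule has_integral_spike[OF neg])
      show "(k has_integral (f b - f a)) {a..b}"
        by (subst has_integral_componentwise_iff) (simp add: ki int[OF _ that] inner_diff_left)
    qed (use eq in auto)
  qed
qed

text \<open>A difference quotient is bounded by \<open>C\<close>, and it differs from the derivative
  by a remainder tending to 0. The local form on an open set serves for paths whose Lipschitz bound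
  is known only on an open interval.\<close>

lemma norm_vector_derivative_le_lipschitz:
  fixes f :: "real \<Rightarrow> 'a::real_normed_vector"
  assumes f: "C-lipschitz_on S f" and d: "(f has_vector_derivative f') (at t)" and S: "open S" "t \<in> S"
  shows "norm f' \<le> C"
proof -
  let ?r = "\<lambda>y. norm (f y - f t - (y - t) *\<^sub>R f') / norm (y - t)"
  have "(?r \<longlongrightarrow> 0) (at t)"
    using d by (simp add: has_vector_derivative_def has_derivative_iff_norm)
  then have "((\<lambda>y. C + ?r y) \<longlongrightarrow> C + 0) (at t)" by (intro tendsto_intros)
  moreover have "\<forall>\<^sub>F y in at t. norm f' \<le> C + ?r y"
    using eventually_at_in_open[OF S]
  proof eventually_elim
    case (elim y)
    then have "norm (f y - f t) \<le> C * \<bar>y - t\<bar>"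
      using lipschitz_onD[OF f, of y t] S by (auto simp: dist_norm)
    then have "\<bar>y - t\<bar> * norm f' \<le> C * \<bar>y - t\<bar> + norm (f y - f t - (y - t) *\<^sub>R f')"
      using norm_triangle_ineq4[of "f y - f t" "f y - f t - (y - t) *\<^sub>R f'"] by simp
    then have "norm f' \<le> (C * \<bar>y - t\<bar> + norm (f y - f t - (y - t) *\<^sub>R f')) / \<bar>y - t\<bar>"
      using elim by (subst pos_le_divide_eq) (auto simp: mult.commute)
    then show ?case using elim by (simp add: add_divide_distrib)
  qed
  ultimately show ?thesis using tendsto_lowerbound[of _ "C + 0" "at t" "norm f'"] by auto
qed

text \<open>Setting the velocity to 0 on the exceptional null set gives the bound by 1 at every
  time, as the integral estimates below require, and leaves all integrals unchanged.\<close>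

lemma unit_speed_velocity:
  fixes q :: "real \<Rightarrow> 'a::euclidean_space"
  assumes q: "1-lipschitz_on UNIV q"
  obtains N v where "negligible N" "\<And>t. t \<notin> N \<Longrightarrow> (q has_vector_derivative v t) (at t)"
    "\<And>t. t \<notin> N \<Longrightarrow> vector_derivative q (at t) = v t" "\<And>t. norm (v t) \<le> 1"
    "\<And>a b. a \<le> b \<Longrightarrow> (v has_integral (q b - q a)) {a..b}"
proof -
  obtain N where N: "negligible N"
    and d: "\<And>t. t \<notin> N \<Longrightarrow> (q has_vector_derivative vector_derivative q (at t)) (at t)"
    and i: "\<And>a b. a \<le> b \<Longrightarrow> ((\<lambda>t. vector_derivative q (at t)) has_integral (q b - q a)) {a..b}"
    by (rule lipschitz_AE_vector_derivative[OF q]) blast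
  define v where "v = (\<lambda>t. if t \<in> N then 0 else vector_derivative q (at t))"
  show thesis
  proof (rule that[OF N])
    fix t
    show "norm (v t) \<le> 1"
      using norm_vector_derivative_le_lipschitz[OF q d, of t] by (simp add: v_def)
  next
    fix a b :: real assume "a \<le> b"
    show "(v has_integral (q b - q a)) {a..b}"
      by (rule has_integral_spike[OF N _ i[OF \<open>a \<le> b\<close>]]) (simp add: v_def)
  qed (use d in \<open>auto simp: v_def\<close>)
qed

section \<open>Integrability of the kinetic and magnetic integrands\<close>

lemma integrable_sqrt_one_minus_norm_sq:
  fixes v :: "real \<Rightarrow> 'a::euclidean_space"
  assumes "v integrable_on {a..b}" "\<And>t. norm (v t) \<le> 1"
  shows "(\<lambda>t. sqrt (1 - (norm (v t))\<^sup>2)) integrable_on {a..b}"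
proof (rule measurable_bounded_by_integrable_imp_integrable)
  have [measurable]: "v \<in> borel_measurable (lebesgue_on {a..b})"
    using assms(1) by (rule integrable_imp_measurable)
  show "(\<lambda>t. sqrt (1 - (norm (v t))\<^sup>2)) \<in> borel_measurable (lebesgue_on {a..b})" by measurable
  show "(\<lambda>t. 1::real) integrable_on {a..b}" by (rule integrable_const_ivl)
  show "norm (sqrt (1 - (norm (v t))\<^sup>2)) \<le> 1" for t
    using assms(2)[of t] by (simp add: power_le_one)
qed simp

lemma integrable_inner_continuous:
  fixes v B :: "real \<Rightarrow> 'a::euclidean_space"
  assumes "v integrable_on {a..b}" "\<And>t. norm (v t) \<le> 1" "continuous_on {a..b} B"
  shows "(\<lambda>t. v t \<bullet> B t) integrable_on {a..b}"
proof (rule measurable_bounded_by_integrable_imp_integrable)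
  have [measurable]: "v \<in> borel_measurable (lebesgue_on {a..b})"
    using assms(1) by (rule integrable_imp_measurable)
  have [measurable]: "B \<in> borel_measurable (lebesgue_on {a..b})"
    using assms(3) by (intro continuous_imp_measurable_on_sets_lebesgue) auto
  show "(\<lambda>t. v t \<bullet> B t) \<in> borel_measurable (lebesgue_on {a..b})" by measurable
  show "(\<lambda>t. norm (B t)) integrable_on {a..b}"
    using assms(3) by (intro integrable_continuous_real continuous_intros)
  show "norm (v t \<bullet> B t) \<le> norm (B t)" for t
    using Cauchy_Schwarz_ineq2[of "v t" "B t"] mult_right_mono[OF assms(2)[of t], of "norm (B t)"] by simp
qed simp

section \<open>Regularity of the vector potential\<close>

lemma C1_R4_continuous:
  assumes "C1_R4 A"
  shows "continuous_on X (\<lambda>p. A (fst p) (snd p))"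
proof -
  obtain D :: "real \<times> vec3 \<Rightarrow> (real \<times> vec3) \<Rightarrow>\<^sub>L vec3" where
    "\<And>z. ((\<lambda>p. A (fst p) (snd p)) has_derivative blinfun_apply (D z)) (at z)"
    using assms by (auto simp: C1_R4_def)
  then show ?thesis
    by (meson continuous_at_imp_continuous_on has_derivative_continuous)
qed

text \<open>The derivative is continuous, hence bounded on the compact ball, and the ball is convex,
  so the mean value inequality applies.\<close>

lemma C1_R4_lipschitz_on_cball:
  assumes "C1_R4 A"
  obtains L where "L-lipschitz_on (cball 0 R) (\<lambda>p. A (fst p) (snd p))"
proof -
  obtain D :: "real \<times> vec3 \<Rightarrow> (real \<times> vec3) \<Rightarrow>\<^sub>L vec3" where
    D: "\<And>z. ((\<lambda>p. A (fst p) (snd p)) has_derivative blinfun_apply (D z)) (at z)"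
    and Dc: "continuous_on UNIV D"
    using assms by (auto simp: C1_R4_def)
  have "compact (D ` cball 0 R)"
    using Dc by (intro compact_continuous_image) (auto intro: continuous_on_subset)
  then obtain L where L: "L > 0" "\<And>z. z \<in> cball 0 R \<Longrightarrow> norm (D z) \<le> L"
    using compact_imp_bounded bounded_pos by (metis imageI)
  have "L-lipschitz_on (cball 0 R) (\<lambda>p. A (fst p) (snd p))"
  proof (rule lipschitz_onI)
    fix x y :: "real \<times> vec3" assume "x \<in> cball 0 R" "y \<in> cball 0 R"
    then show "dist (A (fst x) (snd x)) (A (fst y) (snd y)) \<le> L * dist x y"
      unfolding dist_norm
      by (intro differentiable_bound[where f' = "\<lambda>z. blinfun_apply (D z)" and S = "cball 0 R"])
         (use D L in \<open>auto intro: has_derivative_at_withinI simp: norm_blinfun.rep_eq[symmetric]\<close>)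
  qed (use L in auto)
  then show thesis by (rule that)
qed

text \<open>Adding \<open>M\<close> makes the integrands nonnegative, and Fatou's lemma then applies
  to their Lebesgue integrals. Integrability of the limit is part of the conclusion: the bound alone
  would say little, since a non-integrable function has integral 0 by convention.\<close>

lemma Fatou_integral_le:
  fixes f :: "nat \<Rightarrow> real \<Rightarrow> real"
  assumes f: "\<And>n. f n integrable_on {a..b}" and pos: "\<And>n x. x \<in> {a..b} \<Longrightarrow> - M \<le> f n x"
    and lim: "\<And>x. x \<in> {a..b} \<Longrightarrow> (\<lambda>n. f n x) \<longlonglongrightarrow> g x" and c: "\<And>n. integral {a..b} (f n) \<le> c"
  shows "g integrable_on {a..b}" "integral {a..b} g \<le> c"
proof -
  let ?S = "{a..b}"
  let ?m = "integral ?S (\<lambda>x. M)"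
  have const: "((\<lambda>x. M) has_integral ?m) ?S"
    by (rule integrable_integral[OF integrable_const_ivl])
  define F where "F = (\<lambda>n x. if x \<in> ?S then f n x + M else 0)"
  define G where "G = (\<lambda>x. if x \<in> ?S then g x + M else 0)"
  have F0: "0 \<le> F n x" for n x using pos[of x n] by (auto simp: F_def)
  have G0: "0 \<le> G x" for x
  proof (cases "x \<in> ?S")
    case True
    then have "- M \<le> g x" using lim[OF True] pos by (intro LIMSEQ_le_const) auto
    then show ?thesis by (auto simp: G_def)
  qed (auto simp: G_def)
  have FG: "(\<lambda>n. F n x) \<longlonglongrightarrow> G x" for x
    using lim[of x] by (auto simp: F_def G_def intro!: tendsto_intros)
  have "((\<lambda>x. f n x + M) has_integral (integral ?S (f n) + ?m)) ?S" for n
    using f[of n] const by (intro has_integral_add) auto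
  then have "(F n has_integral (integral ?S (f n) + ?m)) UNIV" for n
    unfolding F_def has_integral_restrict_UNIV .
  then have F: "F n \<in> borel_measurable lebesgue" "integral\<^sup>N lebesgue (F n) = ennreal (integral ?S (f n) + ?m)"
    "0 \<le> integral ?S (f n) + ?m" for n
    using has_integral_iff_nn_integral_lebesgue[of "F n"] F0 by blast+
  have Gm: "G \<in> borel_measurable lebesgue"
    by (rule borel_measurable_LIMSEQ_real[OF FG F(1)])
  have "integral\<^sup>N lebesgue (\<lambda>x. ennreal (G x)) = integral\<^sup>N lebesgue (\<lambda>x. liminf (\<lambda>n. ennreal (F n x)))"
    by (intro nn_integral_cong lim_imp_Liminf[symmetric] tendsto_ennrealI FG) simp
  also have "\<dots> \<le> liminf (\<lambda>n. integral\<^sup>N lebesgue (F n))"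
    using F(1) by (intro nn_integral_liminf) auto
  also have "\<dots> \<le> ennreal (c + ?m)"
  proof (rule Liminf_le)
    show "\<forall>\<^sub>F n in sequentially. integral\<^sup>N lebesgue (F n) \<le> ennreal (c + ?m)"
      using c by (intro always_eventually allI) (auto simp: F(2) intro!: ennreal_leI)
  qed simp
  finally have le: "integral\<^sup>N lebesgue (\<lambda>x. ennreal (G x)) \<le> ennreal (c + ?m)" .
  then obtain r where r: "integral\<^sup>N lebesgue (\<lambda>x. ennreal (G x)) = ennreal r" "0 \<le> r"
    by (metis ennreal_cases ennreal_neq_top neq_top_trans)
  have "0 \<le> c + ?m" using F(3)[of 0] c[of 0] by linarith
  then have "r \<le> c + ?m" using le r by simp
  have "(G has_integral r) UNIV"
    using has_integral_iff_nn_integral_lebesgue[of G] G0 Gm r by blast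
  then have "((\<lambda>x. g x + M) has_integral r) ?S" unfolding G_def has_integral_restrict_UNIV .
  from has_integral_diff[OF this const] have "(g has_integral (r - ?m)) ?S" by simp
  then show "g integrable_on ?S" "integral ?S g \<le> c"
    using \<open>r \<le> c + ?m\<close> by (auto simp: has_integral_iff)
qed

subsection \<open>Lower semicontinuity of the kinetic and magnetic terms\<close>

definition kinetic :: "real \<Rightarrow> (real \<Rightarrow> vec3) \<Rightarrow> real" where
  "kinetic T q = integral {0..T} (\<lambda>t. 1 - sqrt (1 - (norm (vector_derivative q (at t)))\<^sup>2))"

definition magnetic :: "real \<Rightarrow> (real \<Rightarrow> vec3 \<Rightarrow> vec3) \<Rightarrow> (real \<Rightarrow> vec3) \<Rightarrow> real" where
  "magnetic T A q = integral {0..T} (\<lambda>t. vector_derivative q (at t) \<bullet> A t (q t))"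

lemma kinetic_eq:
  assumes "T \<ge> 0" "negligible N" "\<And>t. t \<notin> N \<Longrightarrow> vector_derivative q (at t) = v t"
    and "v integrable_on {0..T}" "\<And>t. norm (v t) \<le> 1"
  shows "kinetic T q = T - integral {0..T} (\<lambda>t. sqrt (1 - (norm (v t))\<^sup>2))"
proof -
  have "kinetic T q = integral {0..T} (\<lambda>t. 1 - sqrt (1 - (norm (v t))\<^sup>2))"
    unfolding kinetic_def by (rule integral_spike[OF assms(2)]) (simp add: assms(3))
  also have "\<dots> = integral {0..T} (\<lambda>t. 1) - integral {0..T} (\<lambda>t. sqrt (1 - (norm (v t))\<^sup>2))"
    by (intro Henstock_Kurzweil_Integration.integral_diff integrable_sqrt_one_minus_norm_sq assms
        integrable_const_ivl)
  finally show ?thesis using assms(1) by simp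
qed

text \<open>No regularity of \<open>q\<close> enters: \<open>sqrt\<close> is monotone on all reals,
  so the integrand is nonnegative whatever the derivative is, and a non-integrable integrand
  contributes 0.\<close>

lemma kinetic_nonneg: "0 \<le> kinetic T q"
  unfolding kinetic_def
proof (cases "(\<lambda>t. 1 - sqrt (1 - (norm (vector_derivative q (at t)))\<^sup>2)) integrable_on {0..T}")
  case True
  then show "0 \<le> integral {0..T} (\<lambda>t. 1 - sqrt (1 - (norm (vector_derivative q (at t)))\<^sup>2))"
    by (rule integral_nonneg) simp
qed (simp add: not_integrable_integral)

lemma continuous_on_along_path:
  assumes "C1_R4 A" "continuous_on X q"
  shows "continuous_on X (\<lambda>t. A t (q t))"
proof -
  have "continuous_on X ((\<lambda>p. A (fst p) (snd p)) \<circ> (\<lambda>t. (t, q t)))"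
    by (intro continuous_on_compose C1_R4_continuous[OF assms(1)] continuous_intros assms(2))
  then show ?thesis by (simp add: o_def)
qed

lemma magnetic_integrable:
  assumes A: "C1_R4 A" and q: "1-lipschitz_on UNIV q"
  shows "(\<lambda>t. vector_derivative q (at t) \<bullet> A t (q t)) integrable_on {a..b}"
proof -
  obtain N v where v: "negligible N" "\<And>t. t \<notin> N \<Longrightarrow> vector_derivative q (at t) = v t"
    "\<And>t. norm (v t) \<le> 1" "\<And>a b. a \<le> b \<Longrightarrow> (v has_integral (q b - q a)) {a..b}"
    by (rule unit_speed_velocity[OF q]) blast
  have "v integrable_on {a..b}"
    using v(4)[of a b] by (cases "a \<le> b") (auto intro: has_integral_integrable)
  moreover have "continuous_on {a..b} (\<lambda>t. A t (q t))"
    by (rule continuous_on_along_path[OF A continuous_on_subset[OF lipschitz_on_continuous_on[OF q]]]) simp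
  ultimately have "(\<lambda>t. v t \<bullet> A t (q t)) integrable_on {a..b}"
    by (intro integrable_inner_continuous v)
  then show ?thesis by (rule integrable_spike[OF _ v(1)]) (simp add: v(2))
qed

text \<open>Both terms are studied through their cumulative integrals \<open>\<sigma> n\<close> and
  \<open>\<tau> n\<close>, which converge uniformly along a subsequence. The limit of the first has
  derivative at most \<open>sqrt (1 - (norm (u t))\<^sup>2)\<close>, where \<open>u\<close> is the
  velocity of \<open>p\<close>. The derivative of the second is identified exactly, because
  increments of \<open>\<tau> n\<close> equal those of \<open>q n\<close> tested against a frozen
  value of \<open>A\<close> up to a quadratic error uniform in \<open>n\<close>.\<close>

theorem action_lower_semicontinuous:
  assumes T: "T > 0" and A: "C1_R4 A"
    and q: "\<And>n. 1-lipschitz_on UNIV (q n)" and p: "1-lipschitz_on UNIV p"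
    and lim: "\<And>t. t \<in> {0..T} \<Longrightarrow> (\<lambda>n. q n t) \<longlonglongrightarrow> p t"
    and R: "\<And>n t. t \<in> {0..T} \<Longrightarrow> norm (q n t) \<le> R"
  obtains k l where "strict_mono (k :: nat \<Rightarrow> nat)"
    "(\<lambda>n. kinetic T (q (k n)) + magnetic T A (q (k n))) \<longlonglongrightarrow> l"
    "kinetic T p + magnetic T A p \<le> l"
proof -

  \<comment> \<open>Uniform bounds on the vector potential along the paths\<close>
  obtain L where L: "L-lipschitz_on (cball 0 (T + R)) (\<lambda>p. A (fst p) (snd p))"
    by (rule C1_R4_lipschitz_on_cball[OF A])
  have "L \<ge> 0" using L lipschitz_on_nonneg by blast
  have "R \<ge> 0" using order_trans[OF norm_ge_zero R[of 0 0]] T by simp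
  have Rp: "norm (p t) \<le> R" if "t \<in> {0..T}" for t
    using R that by (intro Lim_norm_ubound[OF _ lim[OF that]]) auto
  have inball: "(t, x) \<in> cball 0 (T + R)" if "t \<in> {0..T}" "norm x \<le> R" for t :: real and x :: vec3
    using that norm_Pair_le[of t x] by auto
  \<comment> \<open>The factor 2 arises because the time and the position each change by at most
    \<open>\<bar>s - t\<bar>\<close>.\<close>
  have BL: "norm (A s (r s) - A t (r t)) \<le> 2 * L * \<bar>s - t\<bar>"
    if "1-lipschitz_on UNIV r" "\<And>t. t \<in> {0..T} \<Longrightarrow> norm (r t) \<le> R" "s \<in> {0..T}" "t \<in> {0..T}" for r s t
  proof -
    have le: "norm (A s (r s) - A t (r t)) \<le> L * norm ((s, r s) - (t, r t))"
      using lipschitz_onD[OF L, of "(s, r s)" "(t, r t)"] inball that by (simp add: dist_norm)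
    have 1: "norm ((s, r s) - (t, r t)) \<le> \<bar>s - t\<bar> + norm (r s - r t)"
      using norm_Pair_le[of "s - t" "r s - r t"] by simp
    have 2: "norm (r s - r t) \<le> \<bar>s - t\<bar>"
      using lipschitz_onD[OF that(1), of s t] by (simp add: dist_norm)
    have "norm ((s, r s) - (t, r t)) \<le> 2 * \<bar>s - t\<bar>"
      using order_trans[OF 1 add_left_mono[OF 2]] by simp
    from mult_left_mono[OF this \<open>L \<ge> 0\<close>] le show ?thesis by simp
  qed
  define M where "M = norm (A 0 0) + L * (T + R)"
  have "M \<ge> 0" using \<open>L \<ge> 0\<close> \<open>R \<ge> 0\<close> T by (simp add: M_def)
  have AM: "norm (A t x) \<le> M" if "t \<in> {0..T}" "norm x \<le> R" for t x
  proof -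
    have "norm (A t x - A 0 0) \<le> L * norm (t, x)"
      using lipschitz_onD[OF L, of "(t, x)" "(0, 0)"] inball[OF that] T \<open>R \<ge> 0\<close>
      by (simp add: dist_norm zero_prod_def)
    also have "\<dots> \<le> L * (T + R)" using inball[OF that] \<open>L \<ge> 0\<close> by (simp add: mult_left_mono)
    finally show ?thesis using norm_triangle_ineq2[of "A t x" "A 0 0"] by (simp add: M_def)
  qed

  \<comment> \<open>Cumulative kinetic and magnetic integrals\<close>
  have "\<forall>n. \<exists>N v. negligible N \<and> (\<forall>t. t \<notin> N \<longrightarrow> vector_derivative (q n) (at t) = v t)
     \<and> (\<forall>t. norm (v t) \<le> 1) \<and> (\<forall>a b. a \<le> b \<longrightarrow> (v has_integral (q n b - q n a)) {a..b})"
  proof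
    fix n show "\<exists>N v. negligible N \<and> (\<forall>t. t \<notin> N \<longrightarrow> vector_derivative (q n) (at t) = v t)
     \<and> (\<forall>t. norm (v t) \<le> 1) \<and> (\<forall>a b. a \<le> b \<longrightarrow> (v has_integral (q n b - q n a)) {a..b})"
      by (rule unit_speed_velocity[OF q[of n]]) blast
  qed
  then obtain N v where N: "\<And>n. negligible (N n)"
    and vd: "\<And>n t. t \<notin> N n \<Longrightarrow> vector_derivative (q n) (at t) = v n t"
    and v1: "\<And>n t. norm (v n t) \<le> 1"
    and vi: "\<And>n a b. a \<le> b \<Longrightarrow> (v n has_integral (q n b - q n a)) {a..b}" by metis
  have vint: "v n integrable_on {a..b}" for n a b
    using vi[of a b n] by (cases "a \<le> b") (auto intro: has_integral_integrable)
  have Bc: "continuous_on X (\<lambda>t. A t (q n t))" for n X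
    by (rule continuous_on_along_path[OF A continuous_on_subset[OF lipschitz_on_continuous_on[OF q]]]) simp
  define s where "s = (\<lambda>n t. sqrt (1 - (norm (v n t))\<^sup>2))"
  define w where "w = (\<lambda>n t. v n t \<bullet> A t (q n t))"
  have si: "s n integrable_on {a..b}" for n a b
    unfolding s_def by (intro integrable_sqrt_one_minus_norm_sq vint v1)
  have wi: "w n integrable_on {a..b}" for n a b
    unfolding w_def by (intro integrable_inner_continuous vint v1 Bc)
  define \<sigma> where "\<sigma> = (\<lambda>n t. integral {0..t} (s n))"
  define \<tau> where "\<tau> = (\<lambda>n t. integral {0..t} (w n))"
  have \<sigma>d: "(s n has_integral (\<sigma> n b - \<sigma> n a)) {a..b}" if "0 \<le> a" "a \<le> b" for n a b
  proof -
    have "integral {a..b} (s n) = \<sigma> n b - \<sigma> n a"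
      using Henstock_Kurzweil_Integration.integral_combine[OF that si, of n] unfolding \<sigma>_def by linarith
    then show ?thesis using integrable_integral[OF si[of n a b]] by simp
  qed
  have \<tau>d: "(w n has_integral (\<tau> n b - \<tau> n a)) {a..b}" if "0 \<le> a" "a \<le> b" for n a b
  proof -
    have "integral {a..b} (w n) = \<tau> n b - \<tau> n a"
      using Henstock_Kurzweil_Integration.integral_combine[OF that wi, of n] unfolding \<tau>_def by linarith
    then show ?thesis using integrable_integral[OF wi[of n a b]] by simp
  qed
  \<comment> \<open>The combined velocity \<open>(s n t, v n t)\<close> has norm exactly 1. This
    couples the kinetic integral to the displacement by an inequality that survives pointwise
    limits.\<close>
  have unit: "norm (\<sigma> n b - \<sigma> n a, q n b - q n a) \<le> b - a" if ab: "0 \<le> a" "a \<le> b" for n a b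
  proof -
    have bl: "bounded_linear (\<lambda>x::real. (x, 0::vec3))" "bounded_linear (\<lambda>x::vec3. (0::real, x))"
      by (intro bounded_linear_Pair bounded_linear_ident bounded_linear_zero)+
    have "((\<lambda>t. (s n t, 0) + (0, v n t)) has_integral ((\<sigma> n b - \<sigma> n a, 0) + (0, q n b - q n a))) {a..b}"
      using has_integral_add[OF has_integral_linear[OF \<sigma>d[OF ab, of n] bl(1)]
          has_integral_linear[OF vi[OF ab(2), of n] bl(2)]] by (simp add: o_def)
    then have "norm ((\<sigma> n b - \<sigma> n a, 0) + (0, q n b - q n a)) \<le> 1 * measure lborel (cbox a b)"
    proof (intro has_integral_bound[where f = "\<lambda>t. (s n t, 0) + (0, v n t)"])
      fix t
      have "(norm (v n t))\<^sup>2 \<le> 1" using v1[of n t] by (simp add: power_le_one)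
      then show "norm ((s n t, 0) + (0, v n t)) \<le> 1"
        by (simp add: norm_Pair s_def)
    qed auto
    then show ?thesis using ab by simp
  qed
  \<comment> \<open>\<open>A\<close> is frozen at a time \<open>c\<close> of the interval. Since
    \<open>c\<close> is free, it can later be taken as either endpoint, which gives derivatives from
    both sides.\<close>
  have wbound: "norm (\<tau> n b - \<tau> n a - (q n b - q n a) \<bullet> A c (q n c)) \<le> 2 * L * (b - a) * (b - a)"
    if ab: "0 \<le> a" "a \<le> b" "b \<le> T" "c \<in> {a..b}" for n a b c
  proof -
    have "((\<lambda>t. v n t \<bullet> A c (q n c)) has_integral ((q n b - q n a) \<bullet> A c (q n c))) {a..b}"
      using has_integral_linear[OF vi[OF ab(2), of n] bounded_linear_inner_left[of "A c (q n c)"]]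
      by (simp add: o_def)
    from has_integral_diff[OF \<tau>d[OF ab(1,2), of n] this]
    have "((\<lambda>t. w n t - v n t \<bullet> A c (q n c)) has_integral
       (\<tau> n b - \<tau> n a - (q n b - q n a) \<bullet> A c (q n c))) (cbox a b)" by simp
    then have "norm (\<tau> n b - \<tau> n a - (q n b - q n a) \<bullet> A c (q n c)) \<le> (2 * L * (b - a)) * measure lborel (cbox a b)"
    proof (intro has_integral_bound[where f = "\<lambda>t. w n t - v n t \<bullet> A c (q n c)"])
      fix t assume t: "t \<in> cbox a b"
      have "norm (w n t - v n t \<bullet> A c (q n c)) = norm (v n t \<bullet> (A t (q n t) - A c (q n c)))"
        by (simp add: w_def inner_diff_right)
      also have "\<dots> \<le> norm (v n t) * norm (A t (q n t) - A c (q n c))"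
        using Cauchy_Schwarz_ineq2 by simp
      also have "\<dots> \<le> 1 * norm (A t (q n t) - A c (q n c))"
        by (intro mult_right_mono v1) simp
      also have "\<dots> \<le> 2 * L * \<bar>t - c\<bar>" using BL[OF q R, of t c n] ab t by simp
      also have "\<dots> \<le> 2 * L * (b - a)" using \<open>L \<ge> 0\<close> t ab by (intro mult_left_mono) auto
      finally show "norm (w n t - v n t \<bullet> A c (q n c)) \<le> 2 * L * (b - a)" .
    qed (use \<open>L \<ge> 0\<close> ab in auto)
    then show ?thesis using ab by simp
  qed
  have \<tau>lip: "norm (\<tau> n b - \<tau> n a) \<le> M * (b - a)" if ab: "0 \<le> a" "a \<le> b" "b \<le> T" for n a b
  proof -
    have "(w n has_integral (\<tau> n b - \<tau> n a)) (cbox a b)" using \<tau>d[OF ab(1,2)] by simp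
    then have "norm (\<tau> n b - \<tau> n a) \<le> M * measure lborel (cbox a b)"
    proof (intro has_integral_bound[where f = "w n"])
      fix t assume t: "t \<in> cbox a b"
      have "norm (w n t) \<le> norm (v n t) * norm (A t (q n t))"
        using Cauchy_Schwarz_ineq2 by (simp add: w_def)
      also have "\<dots> \<le> 1 * M" using AM[of t "q n t"] R[of t n] t ab v1 by (intro mult_mono) auto
      finally show "norm (w n t) \<le> M" by simp
    qed (use \<open>M \<ge> 0\<close> in auto)
    then show ?thesis using ab by simp
  qed
  have Flip: "norm ((\<sigma> n a, \<tau> n a) - (\<sigma> n b, \<tau> n b)) \<le> (M + 1) * \<bar>a - b\<bar>"
    if "a \<in> {0..T}" "b \<in> {0..T}" for n a b
  proof -
    have *: "norm ((\<sigma> n b, \<tau> n b) - (\<sigma> n a, \<tau> n a)) \<le> (M + 1) * (b - a)" if ab: "0 \<le> a" "a \<le> b" "b \<le> T" for a b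
    proof -
      have "norm ((\<sigma> n b, \<tau> n b) - (\<sigma> n a, \<tau> n a)) \<le> norm (\<sigma> n b - \<sigma> n a) + norm (\<tau> n b - \<tau> n a)"
        using norm_Pair_le[of "\<sigma> n b - \<sigma> n a" "\<tau> n b - \<tau> n a"] by simp
      moreover have "norm (\<sigma> n b - \<sigma> n a) \<le> norm (\<sigma> n b - \<sigma> n a, q n b - q n a)"
        by (rule norm_fst_le)
      ultimately show ?thesis using unit[OF ab(1,2), of n] \<tau>lip[OF ab, of n] by (simp add: algebra_simps)
    qed
    show ?thesis
    proof (cases "a \<le> b")
      case True
      then show ?thesis using *[of a b] that by (subst norm_minus_commute) simp
    next
      case False
      then show ?thesis using *[of b a] that by simp
    qed
  qed

  \<comment> \<open>Convergent subsequence and estimates for the limits\<close>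
  have F0: "(\<sigma> n 0, \<tau> n 0) = 0" for n by (simp add: \<sigma>_def \<tau>_def zero_prod_def)
  obtain g k where k: "strict_mono (k :: nat \<Rightarrow> nat)"
    and gk: "\<And>e. 0 < e \<Longrightarrow> \<exists>N. \<forall>n x. n \<ge> N \<and> x \<in> {0..T} \<longrightarrow> norm((\<sigma> (k n) x, \<tau> (k n) x) - g x) < e"
  proof (rule Arzela_Ascoli[of "{0..T}" "\<lambda>n t. (\<sigma> n t, \<tau> n t)" "(M + 1) * T"])
    show "norm (\<sigma> n x, \<tau> n x) \<le> (M + 1) * T" if "x \<in> {0..T}" for n x
    proof -
      have "norm (\<sigma> n x, \<tau> n x) \<le> (M + 1) * x" using Flip[of x 0 n] that T unfolding F0 by simp
      also have "\<dots> \<le> (M + 1) * T" using that \<open>M \<ge> 0\<close> by (intro mult_left_mono) auto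
      finally show ?thesis .
    qed
    show "\<exists>d>0. \<forall>n y. y \<in> {0..T} \<and> norm (x - y) < d \<longrightarrow> norm ((\<sigma> n x, \<tau> n x) - (\<sigma> n y, \<tau> n y)) < e"
      if x: "x \<in> {0..T}" and "0 < e" for x e
    proof (intro exI[of _ "e / (M + 1)"] conjI allI impI)
      show "0 < e / (M + 1)" using \<open>M \<ge> 0\<close> \<open>e > 0\<close> by simp
      fix n y assume y: "y \<in> {0..T} \<and> norm (x - y) < e / (M + 1)"
      then have "(M + 1) * \<bar>x - y\<bar> < e" using \<open>M \<ge> 0\<close> by (simp add: field_simps)
      then show "norm ((\<sigma> n x, \<tau> n x) - (\<sigma> n y, \<tau> n y)) < e" using Flip[OF x, of y n] y by simp
    qed
  qed auto
  have glim: "(\<lambda>n. (\<sigma> (k n) t, \<tau> (k n) t)) \<longlonglongrightarrow> g t" if "t \<in> {0..T}" for t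
    unfolding LIMSEQ_iff using gk that by blast
  define \<sigma>' where "\<sigma>' = fst \<circ> g"
  define \<tau>' where "\<tau>' = snd \<circ> g"
  have \<sigma>lim: "(\<lambda>n. \<sigma> (k n) t) \<longlonglongrightarrow> \<sigma>' t" and \<tau>lim: "(\<lambda>n. \<tau> (k n) t) \<longlonglongrightarrow> \<tau>' t" if "t \<in> {0..T}" for t
    using tendsto_fst[OF glim[OF that]] tendsto_snd[OF glim[OF that]] by (auto simp: \<sigma>'_def \<tau>'_def)
  have plim: "(\<lambda>n. q (k n) t) \<longlonglongrightarrow> p t" if "t \<in> {0..T}" for t
    using LIMSEQ_subseq_LIMSEQ[OF lim[OF that] k] by (simp add: o_def)
  have Alim: "(\<lambda>n. A t (q (k n) t)) \<longlonglongrightarrow> A t (p t)" if "t \<in> {0..T}" for t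
  proof -
    have "isCont (\<lambda>p. A (fst p) (snd p)) (t, p t)"
      using C1_R4_continuous[OF A, of UNIV] by (simp add: continuous_on_eq_continuous_at)
    from isCont_tendsto_compose[OF this tendsto_Pair[OF tendsto_const plim[OF that]]]
    show ?thesis by simp
  qed
  have unit': "norm (\<sigma>' b - \<sigma>' a, p b - p a) \<le> b - a" if ab: "0 \<le> a" "a \<le> b" "b \<le> T" for a b
  proof (rule Lim_norm_ubound)
    show "(\<lambda>n. (\<sigma> (k n) b - \<sigma> (k n) a, q (k n) b - q (k n) a)) \<longlonglongrightarrow> (\<sigma>' b - \<sigma>' a, p b - p a)"
      using ab by (intro tendsto_intros \<sigma>lim plim) auto
  qed (use unit ab in auto)
  have wbound': "norm (\<tau>' b - \<tau>' a - (p b - p a) \<bullet> A c (p c)) \<le> 2 * L * (b - a) * (b - a)"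
    if ab: "0 \<le> a" "a \<le> b" "b \<le> T" "c \<in> {a..b}" for a b c
  proof (rule Lim_norm_ubound)
    show "(\<lambda>n. \<tau> (k n) b - \<tau> (k n) a - (q (k n) b - q (k n) a) \<bullet> A c (q (k n) c))
       \<longlonglongrightarrow> \<tau>' b - \<tau>' a - (p b - p a) \<bullet> A c (p c)"
      using ab by (intro tendsto_intros \<tau>lim plim Alim) auto
  qed (use wbound ab in auto)
  have \<tau>lip': "norm (\<tau>' b - \<tau>' a) \<le> M * (b - a)" if ab: "0 \<le> a" "a \<le> b" "b \<le> T" for a b
  proof (rule Lim_norm_ubound)
    show "(\<lambda>n. \<tau> (k n) b - \<tau> (k n) a) \<longlonglongrightarrow> \<tau>' b - \<tau>' a"
      using ab by (intro tendsto_intros \<tau>lim) auto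
  qed (use \<tau>lip ab in auto)
  \<comment> \<open>The limits are controlled only on \<open>{0..T}\<close>. Clamping time to that
    interval extends them to Lipschitz functions on the whole line, as the differentiation theorem
    demands.\<close>
  define c where "c = (\<lambda>t. max 0 (min T t))"
  have cT: "0 \<le> c t" "c t \<le> T" for t using T by (auto simp: c_def)
  have cid: "c t = t" if "t \<in> {0..T}" for t using that by (auto simp: c_def)
  have cm: "c a \<le> c b" "c b - c a \<le> b - a" if "a \<le> b" for a b using that T by (auto simp: c_def)
  have S: "1-lipschitz_on UNIV (\<lambda>t. \<sigma>' (c t))"
  proof (rule lipschitz_on_leI)
    fix x y :: real assume "x \<le> y"
    have "norm (\<sigma>' (c y) - \<sigma>' (c x)) \<le> norm (\<sigma>' (c y) - \<sigma>' (c x), p (c y) - p (c x))"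
      by (rule norm_fst_le)
    then show "dist (\<sigma>' (c x)) (\<sigma>' (c y)) \<le> 1 * dist x y"
      using unit'[OF cT(1) cm(1) cT(2), OF \<open>x \<le> y\<close>] cm(2)[OF \<open>x \<le> y\<close>] \<open>x \<le> y\<close>
      by (simp add: dist_norm norm_minus_commute)
  qed simp
  have Ta: "M-lipschitz_on UNIV (\<lambda>t. \<tau>' (c t))"
  proof (rule lipschitz_on_leI)
    fix x y :: real assume "x \<le> y"
    have "M * (c y - c x) \<le> M * (y - x)" using cm(2)[OF \<open>x \<le> y\<close>] \<open>M \<ge> 0\<close> by (rule mult_left_mono)
    then show "dist (\<tau>' (c x)) (\<tau>' (c y)) \<le> M * dist x y"
      using \<tau>lip'[OF cT(1) cm(1) cT(2), OF \<open>x \<le> y\<close>] \<open>x \<le> y\<close>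
      by (simp add: dist_norm norm_minus_commute)
  qed (rule \<open>M \<ge> 0\<close>)

  \<comment> \<open>Almost everywhere derivatives of the limits\<close>
  obtain N1 where N1: "negligible N1"
    and d1: "\<And>t. t \<notin> N1 \<Longrightarrow> ((\<lambda>t. \<sigma>' (c t)) has_vector_derivative vector_derivative (\<lambda>t. \<sigma>' (c t)) (at t)) (at t)"
    and i1: "\<And>a b. a \<le> b \<Longrightarrow> ((\<lambda>t. vector_derivative (\<lambda>t. \<sigma>' (c t)) (at t)) has_integral (\<sigma>' (c b) - \<sigma>' (c a))) {a..b}"
    by (rule lipschitz_AE_vector_derivative[OF S]) blast
  obtain N2 where N2: "negligible N2"
    and i2: "\<And>a b. a \<le> b \<Longrightarrow> ((\<lambda>t. vector_derivative (\<lambda>t. \<tau>' (c t)) (at t)) has_integral (\<tau>' (c b) - \<tau>' (c a))) {a..b}"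
    by (rule lipschitz_AE_vector_derivative[OF Ta]) blast
  obtain N3 u where N3: "negligible N3"
    and d3: "\<And>t. t \<notin> N3 \<Longrightarrow> (p has_vector_derivative u t) (at t)"
    and e3: "\<And>t. t \<notin> N3 \<Longrightarrow> vector_derivative p (at t) = u t"
    and u1: "\<And>t. norm (u t) \<le> 1"
    and i3: "\<And>a b. a \<le> b \<Longrightarrow> (u has_integral (p b - p a)) {a..b}"
    by (rule unit_speed_velocity[OF p]) blast
  have ui: "u integrable_on {0..T}" using i3[of 0 T] T by auto
  have z0: "\<sigma>' 0 = 0" "\<tau>' 0 = 0"
    using LIMSEQ_unique[OF \<sigma>lim[of 0]] LIMSEQ_unique[OF \<tau>lim[of 0]] T by (auto simp: \<sigma>_def \<tau>_def)
  have ends: "\<sigma>' (c T) - \<sigma>' (c 0) = \<sigma>' T" "\<tau>' (c T) - \<tau>' (c 0) = \<tau>' T"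
    using T by (auto simp: cid z0)
  have sle: "vector_derivative (\<lambda>t. \<sigma>' (c t)) (at t) \<le> sqrt (1 - (norm (u t))\<^sup>2)"
    if t: "0 < t" "t < T" "t \<notin> N1" "t \<notin> N3" for t
  proof -
    let ?d = "vector_derivative (\<lambda>t. \<sigma>' (c t)) (at t)"
    have "1-lipschitz_on {0<..<T} (\<lambda>t. (\<sigma>' (c t), p t))"
    proof (rule lipschitz_on_leI)
      fix x y :: real assume "x \<in> {0<..<T}" "y \<in> {0<..<T}" "x \<le> y"
      then have "dist (\<sigma>' (c y), p y) (\<sigma>' (c x), p x) \<le> y - x"
        unfolding dist_norm using unit'[of x y] by (simp add: cid)
      moreover have "1 * dist x y = y - x" using \<open>x \<le> y\<close> by (simp add: dist_real_def)
      ultimately show "dist (\<sigma>' (c x), p x) (\<sigma>' (c y), p y) \<le> 1 * dist x y"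
        by (simp only: dist_commute[of "(\<sigma>' (c x), p x)"])
    qed simp
    moreover have "((\<lambda>t. (\<sigma>' (c t), p t)) has_vector_derivative (?d, u t)) (at t)"
      using t by (intro has_vector_derivative_Pair d1 d3)
    ultimately have "norm (?d, u t) \<le> 1"
      by (rule norm_vector_derivative_le_lipschitz) (use t in auto)
    then have "?d\<^sup>2 + (norm (u t))\<^sup>2 \<le> 1" by (simp add: norm_Pair)
    then show ?thesis by (intro real_le_rsqrt) simp
  qed
  have wder: "vector_derivative (\<lambda>t. \<tau>' (c t)) (at t) = u t \<bullet> A t (p t)"
    if t: "0 < t" "t < T" "t \<notin> N3" for t
  proof (rule vector_derivative_at)
    define \<phi> where "\<phi> = (\<lambda>y. \<tau>' (c y) - p y \<bullet> A t (p t))"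
    have "\<bar>(\<phi> y - \<phi> t) / (y - t)\<bar> \<le> 2 * L * \<bar>y - t\<bar>" if y: "y \<in> {0<..<T}" "y \<noteq> t" for y
    proof -
      have "\<bar>\<phi> y - \<phi> t\<bar> \<le> 2 * L * \<bar>y - t\<bar> * \<bar>y - t\<bar>"
      proof (cases "t < y")
        case True
        then show ?thesis using wbound'[of t y t] t y
          by (simp add: \<phi>_def cid inner_diff_left algebra_simps)
      next
        case False
        then have "\<bar>\<phi> t - \<phi> y\<bar> \<le> 2 * L * (t - y) * (t - y)" using wbound'[of y t t] t y
          by (simp add: \<phi>_def cid inner_diff_left algebra_simps)
        then show ?thesis using False by (simp add: abs_minus_commute)
      qed
      then show ?thesis using y by (simp add: abs_divide divide_le_eq)
    qed
    then have "\<forall>\<^sub>F y in at t. norm ((\<phi> y - \<phi> t) / (y - t)) \<le> 2 * L * \<bar>y - t\<bar>"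
      using t by (intro eventually_mono[OF eventually_at_in_open[of "{0<..<T}" t]]) simp_all
    moreover have "((\<lambda>y. 2 * L * \<bar>y - t\<bar>) \<longlongrightarrow> 2 * L * \<bar>t - t\<bar>) (at t)"
      by (intro tendsto_intros)
    then have "((\<lambda>y. 2 * L * \<bar>y - t\<bar>) \<longlongrightarrow> 0) (at t)" by simp
    ultimately have "((\<lambda>y. (\<phi> y - \<phi> t) / (y - t)) \<longlongrightarrow> 0) (at t)"
      by (rule Lim_null_comparison)
    then have "(\<phi> has_real_derivative 0) (at t)" unfolding has_field_derivative_iff .
    then have "(\<phi> has_vector_derivative 0) (at t)"
      unfolding has_real_derivative_iff_has_vector_derivative .
    moreover have "((\<lambda>y. p y \<bullet> A t (p t)) has_vector_derivative u t \<bullet> A t (p t)) (at t)"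
      using bounded_linear.has_vector_derivative[OF bounded_linear_inner_left d3[OF t(3)]] .
    ultimately have "((\<lambda>y. \<phi> y + p y \<bullet> A t (p t)) has_vector_derivative 0 + u t \<bullet> A t (p t)) (at t)"
      by (rule has_vector_derivative_add)
    then show "((\<lambda>t. \<tau>' (c t)) has_vector_derivative u t \<bullet> A t (p t)) (at t)"
      by (simp add: \<phi>_def)
  qed

  \<comment> \<open>Integration of the pointwise derivative relations\<close>
  have neg: "negligible (N1 \<union> N3 \<union> {0, T})" using N1 N3 by simp
  have "\<sigma>' T \<le> integral {0..T} (\<lambda>t. sqrt (1 - (norm (u t))\<^sup>2))"
  proof -
    let ?d = "\<lambda>t. vector_derivative (\<lambda>t. \<sigma>' (c t)) (at t)"
    \<comment> \<open>The comparison of integrals wants the inequality at every point, so the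
      derivative is replaced by its upper bound on the exceptional null set.\<close>
    let ?m = "\<lambda>t. if t \<in> N1 \<union> N3 \<union> {0, T} then sqrt (1 - (norm (u t))\<^sup>2) else ?d t"
    have "(?d has_integral \<sigma>' T) {0..T}" using i1[of 0 T] T ends by simp
    then have "(?m has_integral \<sigma>' T) {0..T}"
      by (rule has_integral_spike[OF neg, rotated]) simp
    moreover have "(\<lambda>t. sqrt (1 - (norm (u t))\<^sup>2)) integrable_on {0..T}"
      by (intro integrable_sqrt_one_minus_norm_sq ui u1)
    ultimately show ?thesis
      by (rule has_integral_le[OF _ integrable_integral]) (use sle in simp)
  qed
  then have kin: "kinetic T p \<le> T - \<sigma>' T"
    using kinetic_eq[OF _ N3 e3 ui u1] T by simp
  have "((\<lambda>t. vector_derivative p (at t) \<bullet> A t (p t)) has_integral \<tau>' T) {0..T}"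
    by (rule has_integral_spike[OF neg _ i2[of 0 T, unfolded ends]]) (use wder e3 T in auto)
  then have mag: "magnetic T A p = \<tau>' T" unfolding magnetic_def by (rule integral_unique)
  have "kinetic T (q n) = T - \<sigma> n T" for n
    using kinetic_eq[OF _ N vd vint v1] T by (simp add: \<sigma>_def s_def)
  moreover have "magnetic T A (q n) = \<tau> n T" for n
    unfolding magnetic_def \<tau>_def w_def by (rule integral_spike[OF N[of n]]) (simp add: vd)
  ultimately have "(\<lambda>n. kinetic T (q (k n)) + magnetic T A (q (k n))) \<longlonglongrightarrow> (T - \<sigma>' T) + \<tau>' T"
    using T by (auto intro!: tendsto_intros \<sigma>lim \<tau>lim)
  moreover have "kinetic T p + magnetic T A p \<le> (T - \<sigma>' T) + \<tau>' T" using kin mag by simp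
  ultimately show thesis by (rule that[OF k])
qed

subsection \<open>Coercivity, compactness and avoidance of the singular set\<close>

text \<open>The real value that \<open>Ifun\<close> takes on \<open>KLam\<close>. The magnetic and
  potential terms stay under one integral because splitting it presupposes integrability of the
  potential term.\<close>

definition action :: "real \<Rightarrow> (real \<Rightarrow> vec3 \<Rightarrow> vec3) \<Rightarrow> (real \<Rightarrow> vec3 \<Rightarrow> real) \<Rightarrow> (real \<Rightarrow> vec3) \<Rightarrow> real" where
  "action T A P q = kinetic T q
     + integral {0..T} (\<lambda>t. vector_derivative q (at t) \<bullet> A t (q t) - P t (q t))"

lemma Ifun_eq_action: "q \<in> KLam T S \<Longrightarrow> Ifun T S A P q = ereal (action T A P q)"
  by (simp add: Ifun_def action_def kinetic_def)

text \<open>A linear functional is the inner product with the adjoint applied to 1, and uniqueness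
  of derivatives makes the description in \<open>gradPhi\<close> denote that vector.\<close>

lemma gradPhi_has_derivative:
  assumes "P t differentiable (at x)"
  shows "(P t has_derivative (\<lambda>h. gradPhi P t x \<bullet> h)) (at x)"
proof -
  obtain f' where f': "(P t has_derivative f') (at x)" using assms by (auto simp: differentiable_def)
  then have "linear f'" by (rule has_derivative_linear)
  then have "f' = (\<lambda>h. adjoint f' 1 \<bullet> h)"
    using adjoint_works[of f' _ 1] by (intro ext) (simp add: inner_commute)
  then obtain g where g: "f' = (\<lambda>h. g \<bullet> h)" by blast
  show ?thesis
    unfolding gradPhi_def
  proof (rule theI)
    show "(P t has_derivative (\<lambda>h. g \<bullet> h)) (at x)" using f' unfolding g .
    fix g' assume "(P t has_derivative (\<lambda>h. g' \<bullet> h)) (at x)"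
    from has_derivative_unique[OF this f'] have "g' \<bullet> z = g \<bullet> z" for z unfolding g by (rule fun_cong)
    then show "g' = g" using vector_eq_rdot by blast
  qed
qed

lemma C1_R4_partial_derivatives:
  assumes "C1_R4 A"
  shows "(A t has_derivative gradA A t x) (at x)"
    and "((\<lambda>s. A s x) has_vector_derivative dtA A t x) (at t)"
proof -
  obtain D :: "real \<times> vec3 \<Rightarrow> (real \<times> vec3) \<Rightarrow>\<^sub>L vec3" where
    D: "\<And>z. ((\<lambda>p. A (fst p) (snd p)) has_derivative blinfun_apply (D z)) (at z)"
    using assms by (auto simp: C1_R4_def)
  have "((\<lambda>y. (t, y)) has_derivative (\<lambda>h. (0, h))) (at x)"
    by (auto intro!: derivative_eq_intros)
  from has_derivative_compose[OF this D] have "A t differentiable (at x)"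
    by (auto simp: differentiable_def)
  then show "(A t has_derivative gradA A t x) (at x)"
    unfolding gradA_def by (simp add: frechet_derivative_works)
  have "((\<lambda>s. (s, x)) has_derivative (\<lambda>h. (h, 0))) (at t)"
    by (auto intro!: derivative_eq_intros)
  from has_derivative_compose[OF this D] have "(\<lambda>s. A s x) differentiable (at t)"
    by (auto simp: differentiable_def)
  then show "((\<lambda>s. A s x) has_vector_derivative dtA A t x) (at t)"
    unfolding dtA_def by (simp add: vector_derivative_works)
qed

lemma classP_continuous_time:
  assumes "classP T S P" "x \<notin> S"
  shows "continuous_on X (\<lambda>t. P t x)"
proof -
  have "continuous_on UNIV (\<lambda>t. P t x)" using assms by (simp add: classP_def)
  then show ?thesis by (rule continuous_on_subset) simp
qed

text \<open>A real \<open>Sup\<close> dominates the members only of a set that is bounded above; the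
  global upper bound on \<open>P\<close> supplies this.\<close>

lemma varphi_nonpos:
  assumes T: "T > 0" and P: "classP T S P" and n: "normalized T S P" and x: "x \<notin> S"
  shows "varphi T P x \<le> 0"
proof -
  obtain M where M: "\<And>t x. x \<notin> S \<Longrightarrow> P t x \<le> M" using P by (auto simp: classP_def)
  have "bdd_above (varphi T P ` (- S))"
  proof (rule bdd_aboveI2)
    fix y assume "y \<in> - S"
    then have "(\<lambda>t. P t y) integrable_on {0..T}"
      by (intro integrable_continuous_real classP_continuous_time[OF P]) simp
    then have "varphi T P y \<le> integral {0..T} (\<lambda>t. M)"
      unfolding varphi_def using M \<open>y \<in> - S\<close> by (intro integral_le) auto
    then show "varphi T P y \<le> integral {0..T} (\<lambda>t. M)" .
  qed
  moreover have "varphi T P x \<in> varphi T P ` (- S)" using x by blast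
  ultimately have "varphi T P x \<le> Sup (varphi T P ` (- S))" by (rule cSup_upper[rotated])
  then show ?thesis using n by (simp add: normalized_def)
qed

text \<open>Far away, A is replaced by its value at time 0 and the base point, which integrates to 0
  against the velocity of a loop.\<close>
lemma action_coercive:
  assumes T: "T > 0" and S: "compact S" and A: "classA T A" and P: "classP T S P"
    and nrm: "normalized T S P" and e: "e > 0"
  obtains R where "\<And>q. \<lbrakk>q \<in> KLam T S; R \<le> norm (q 0)\<rbrakk> \<Longrightarrow> - e \<le> action T A P q"
proof -
  have A1: "C1_R4 A" using A by (simp add: classA_def)
  \<comment> \<open>Three errors of size at most \<open>d * T\<close> occur at each time: the
    variation of \<open>A\<close> in space, that of \<open>A\<close> in time and that of
    \<open>P\<close> in space. Integrated over one period they total \<open>e\<close>.\<close>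
  define d where "d = e / (3 * T * T)"
  have d: "d > 0" using e T by (simp add: d_def)
  obtain R1 where R1: "\<And>x. x \<in> S \<Longrightarrow> norm x < R1"
    using compact_imp_bounded[OF S] unfolding bounded_pos_less by blast
  obtain R2 where R2: "\<And>t x. R2 \<le> norm x \<Longrightarrow> norm (dtA A t x) + onorm (gradA A t x) < d"
  proof -
    have "\<forall>e>0. \<exists>R. \<forall>t x. R \<le> norm x \<longrightarrow> norm (dtA A t x) + onorm (gradA A t x) < e"
      using A unfolding classA_def by (elim conjE)
    then show thesis using d that by blast
  qed
  obtain R3 where R3: "\<And>t x. \<lbrakk>x \<notin> S; R3 \<le> norm x\<rbrakk> \<Longrightarrow> norm (gradPhi P t x) < d"
  proof -
    have "\<forall>e>0. \<exists>R. \<forall>t x. x \<notin> S \<and> R \<le> norm x \<longrightarrow> norm (gradPhi P t x) < e"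
      using P unfolding classP_def by (elim conjE)
    then show thesis using d that by blast
  qed
  \<comment> \<open>In one period the loop stays within distance \<open>T\<close> of
    \<open>q 0\<close>. The margin \<open>T\<close> keeps the whole ball of that radius off
    \<open>S\<close> and in the region of small gradients; its convexity permits the mean value
    inequality.\<close>
  define R where "R = max R1 (max R2 R3) + T"
  have "- e \<le> action T A P q" if q: "q \<in> KLam T S" "R \<le> norm (q 0)" for q
  proof (cases "(\<lambda>t. vector_derivative q (at t) \<bullet> A t (q t) - P t (q t)) integrable_on {0..T}")
    case False
    then show ?thesis using kinetic_nonneg[of T q] e by (simp add: action_def not_integrable_integral)
  next
    case True
    let ?x = "q 0" and ?F = "\<lambda>t. vector_derivative q (at t) \<bullet> A t (q t) - P t (q t)"
    have lip: "1-lipschitz_on UNIV q" and per: "q (t + T) = q t" and qS: "q t \<notin> S" for t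
      using q by (auto simp: KLam_def Ksp_def Wsp_def Lam_def)
    have far: "y \<notin> S" "R2 \<le> norm y" "R3 \<le> norm y" if "y \<in> cball ?x T" for y
    proof -
      have "norm (q 0) \<le> norm y + T"
        using that norm_triangle_ineq2[of "q 0" y] by (simp add: dist_norm)
      then have "max R1 (max R2 R3) \<le> norm y" using q(2) unfolding R_def by linarith
      then show "y \<notin> S" "R2 \<le> norm y" "R3 \<le> norm y" using R1[of y] by auto
    qed
    have qin: "q t \<in> cball ?x T" if "t \<in> {0..T}" for t
      using lipschitz_onD[OF lip, of 0 t] that by (simp add: dist_real_def)
    have x0: "?x \<in> cball ?x T" using T by simp
    have grad: "norm (A t (q t) - A t ?x) \<le> d * T" if t: "t \<in> {0..T}" for t
    proof -
      have "norm (A t (q t) - A t ?x) \<le> d * norm (q t - ?x)"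
      proof (rule differentiable_bound[where f' = "gradA A t" and S = "cball ?x T"])
        fix y assume "y \<in> cball ?x T"
        then show "onorm (gradA A t y) \<le> d"
          using R2[OF far(2), of y t] norm_ge_zero[of "dtA A t y"] by linarith
        show "(A t has_derivative gradA A t y) (at y within cball ?x T)"
          by (rule has_derivative_at_withinI[OF C1_R4_partial_derivatives(1)[OF A1]])
      qed (use qin[OF t] x0 in auto)
      also have "\<dots> \<le> d * T"
        using qin[OF t] d by (intro mult_left_mono) (auto simp: dist_norm norm_minus_commute)
      finally show ?thesis .
    qed
    have dt: "norm (A t ?x - A 0 ?x) \<le> d * T" if t: "t \<in> {0..T}" for t
    proof -
      have "norm (A t ?x - A 0 ?x) \<le> d * norm (t - 0)"
      proof (rule differentiable_bound[where f' = "\<lambda>s h. h *\<^sub>R dtA A s ?x" and S = "{0..T}" and f = "\<lambda>s. A s ?x"])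
        fix s assume "s \<in> {0..T}"
        show "((\<lambda>s. A s ?x) has_derivative (\<lambda>h. h *\<^sub>R dtA A s ?x)) (at s within {0..T})"
          using C1_R4_partial_derivatives(2)[OF A1, of ?x s]
          by (auto simp: has_vector_derivative_def intro: has_derivative_at_withinI)
        have "onorm (gradA A s ?x) \<ge> 0"
          by (rule onorm_pos_le[OF has_derivative_bounded_linear[OF C1_R4_partial_derivatives(1)[OF A1]]])
        then have "norm (dtA A s ?x) \<le> d" using R2[OF far(2)[OF x0], of s] by linarith
        then show "onorm (\<lambda>h. h *\<^sub>R dtA A s ?x) \<le> d"
          by (intro onorm_le) (simp add: mult.commute[of d] mult_left_mono)
      qed (use t T in auto)
      also have "\<dots> \<le> d * T" using t d by (intro mult_left_mono) auto
      finally show ?thesis .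
    qed
    have pot: "P t (q t) - P t ?x \<le> d * T" if t: "t \<in> {0..T}" for t
    proof -
      have "norm (P t (q t) - P t ?x) \<le> d * norm (q t - ?x)"
      proof (rule differentiable_bound[where f' = "\<lambda>y h. gradPhi P t y \<bullet> h" and S = "cball ?x T"])
        fix y assume y: "y \<in> cball ?x T"
        have "P t differentiable (at y)" using P far(1)[OF y] by (auto simp: classP_def)
        from gradPhi_has_derivative[of P, OF this]
        show "(P t has_derivative (\<lambda>h. gradPhi P t y \<bullet> h)) (at y within cball ?x T)"
          by (rule has_derivative_at_withinI)
        show "onorm (\<lambda>h. gradPhi P t y \<bullet> h) \<le> d"
        proof (rule onorm_le)
          fix h
          have "norm (gradPhi P t y \<bullet> h) \<le> norm (gradPhi P t y) * norm h" 
            using Cauchy_Schwarz_ineq2 by simp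
          also have "\<dots> \<le> d * norm h" using R3[OF far(1)[OF y] far(3)[OF y], of t] by (intro mult_right_mono) auto
          finally show "norm (gradPhi P t y \<bullet> h) \<le> d * norm h" .
        qed
      qed (use qin[OF t] x0 in auto)
      also have "\<dots> \<le> d * T"
        using qin[OF t] d by (intro mult_left_mono) (auto simp: dist_norm norm_minus_commute)
      finally show ?thesis by simp
    qed
    obtain N v where N: "negligible N"
      and vd: "\<And>t. t \<notin> N \<Longrightarrow> vector_derivative q (at t) = v t"
      and v1: "\<And>t. norm (v t) \<le> 1"
      and vi: "\<And>a b. a \<le> b \<Longrightarrow> (v has_integral (q b - q a)) {a..b}"
      by (rule unit_speed_velocity[OF lip]) blast
    let ?G = "\<lambda>t. v t \<bullet> A 0 ?x - P t ?x - 3 * d * T"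
    have "continuous_on {0..T} (\<lambda>t. P t ?x)"
      by (rule classP_continuous_time[OF P qS])
    then have "((\<lambda>t. P t ?x) has_integral varphi T P ?x) {0..T}"
      unfolding varphi_def by (intro integrable_integral integrable_continuous_real)
    moreover have "((\<lambda>t. v t \<bullet> A 0 ?x) has_integral ((q T - q 0) \<bullet> A 0 ?x)) {0..T}"
      using has_integral_linear[OF vi[of 0 T] bounded_linear_inner_left[of "A 0 ?x"]] T by (simp add: o_def)
    moreover have "q T - q 0 = 0" using per[of 0] by simp
    moreover have "((\<lambda>t. 3 * d * T) has_integral (T * (3 * d * T))) {0..T}"
      using has_integral_const_real[of "3 * d * T" 0 T] T by simp
    ultimately have G: "(?G has_integral (0 - varphi T P ?x - T * (3 * d * T))) {0..T}"
      by (intro has_integral_diff) simp_all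
    have le: "?G t \<le> ?F t" if t: "t \<in> {0..T}" "t \<notin> N" for t
    proof -
      have "norm (v t \<bullet> (A t (q t) - A 0 ?x)) \<le> norm (v t) * norm (A t (q t) - A 0 ?x)"
        using Cauchy_Schwarz_ineq2 by simp
      also have "\<dots> \<le> 1 * norm (A t (q t) - A 0 ?x)" by (intro mult_right_mono v1) simp
      also have "\<dots> \<le> norm (A t (q t) - A t ?x) + norm (A t ?x - A 0 ?x)"
        using norm_triangle_ineq[of "A t (q t) - A t ?x" "A t ?x - A 0 ?x"] by simp
      also have "\<dots> \<le> 2 * d * T" using grad[OF t(1)] dt[OF t(1)] by simp
      finally have "\<bar>v t \<bullet> A t (q t) - v t \<bullet> A 0 ?x\<bar> \<le> 2 * d * T" by (simp add: inner_diff_right)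
      then show ?thesis using pot[OF t(1)] vd[OF t(2)] by simp
    qed
    \<comment> \<open>The integrand is replaced by the lower bound on the null set \<open>N\<close>,
      so that the comparison holds at every time.\<close>
    let ?H = "\<lambda>t. if t \<in> N then ?G t else ?F t"
    have "(?F has_integral integral {0..T} ?F) {0..T}" using True by (rule integrable_integral)
    then have "(?H has_integral integral {0..T} ?F) {0..T}"
      by (rule has_integral_spike[OF N, rotated]) simp
    then have "0 - varphi T P ?x - T * (3 * d * T) \<le> integral {0..T} ?F"
      by (rule has_integral_le[OF G]) (use le in auto)
    moreover have "T * (3 * d * T) = e" using T by (simp add: d_def)
    ultimately show ?thesis
      using varphi_nonpos[OF T P nrm, of ?x] qS kinetic_nonneg[of T q] by (simp add: action_def)
  qed
  then show thesis by (rule that)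
qed

section \<open>Compactness of periodic loops of speed at most 1\<close>

lemma periodic_add_int:
  fixes q :: "real \<Rightarrow> 'a"
  assumes per: "\<And>t. q (t + T) = q t"
  shows "q (t + of_int m * T) = q t"
proof -
  have nat: "q (t + real n * T) = q t" for n t
  proof (induction n)
    case (Suc n)
    have "q (t + real (Suc n) * T) = q ((t + real n * T) + T)" by (simp add: algebra_simps)
    then show ?case using Suc per by simp
  qed simp
  show ?thesis
  proof (cases m)
    case (nonneg n)
    then show ?thesis using nat[of t n] by simp
  next
    case (neg n)
    then have m: "real_of_int m = - real (Suc n)" by simp
    have "(t + of_int m * T) + real (Suc n) * T = t" unfolding m by (simp add: algebra_simps)
    then show ?thesis using nat[of "t + of_int m * T" "Suc n"] by metis
  qed
qed

lemma mod_period_in_interval: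
  fixes T :: real
  assumes "T > 0"
  shows "t + of_int (- \<lfloor>t / T\<rfloor>) * T \<in> {0..<T}"
proof -
  have "of_int \<lfloor>t / T\<rfloor> \<le> t / T" "t / T < of_int \<lfloor>t / T\<rfloor> + 1" by linarith+
  then have "of_int \<lfloor>t / T\<rfloor> * T \<le> t" "t < (of_int \<lfloor>t / T\<rfloor> + 1) * T"
    unfolding pos_le_divide_eq[OF assms] pos_divide_less_eq[OF assms] .
  then show ?thesis by (simp add: algebra_simps)
qed

text \<open>The bound at time 0 and the common Lipschitz constant give a uniformly convergent
  subsequence on one period. The limit is extended by reducing time modulo \<open>T\<close>, and
  periodicity carries the convergence to all times.\<close>

lemma Ksp_bounded_subsequence:
  assumes T: "T > 0" and q: "\<And>n. q n \<in> Ksp T" and R: "\<And>n. norm (q n 0) \<le> R"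
  obtains k p where "strict_mono (k :: nat \<Rightarrow> nat)" "p \<in> Ksp T" "\<And>t. (\<lambda>n. q (k n) t) \<longlonglongrightarrow> p t"
proof -
  have lip: "1-lipschitz_on UNIV (q n)" and per: "q n (t + T) = q n t" for n t
    using q[of n] by (auto simp: Ksp_def Wsp_def)
  have ql: "norm (q n x - q n y) \<le> norm (x - y)" for n x y
    using lipschitz_onD[OF lip[of n], of x y] by (simp add: dist_norm)
  obtain g k where k: "strict_mono (k :: nat \<Rightarrow> nat)"
    and gk: "\<And>e. 0 < e \<Longrightarrow> \<exists>N. \<forall>n x. n \<ge> N \<and> x \<in> {0..T} \<longrightarrow> norm (q (k n) x - g x) < e"
  proof (rule Arzela_Ascoli[of "{0..T}" q "R + T"])
    show "norm (q n x) \<le> R + T" if "x \<in> {0..T}" for n x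
      using ql[of n x 0] R[of n] norm_triangle_ineq2[of "q n x" "q n 0"] that by simp
    show "\<exists>d>0. \<forall>n y. y \<in> {0..T} \<and> norm (x - y) < d \<longrightarrow> norm (q n x - q n y) < e"
      if "0 < e" for x e
      using that order.strict_trans1[OF ql[of _ x]] by (intro exI[of _ e]) simp
  qed auto
  define c where "c = (\<lambda>t. t + of_int (- \<lfloor>t / T\<rfloor>) * T)"
  have c: "c t \<in> {0..T}" for t
  proof -
    have "c t \<in> {0..<T}" unfolding c_def by (rule mod_period_in_interval[OF T])
    then show ?thesis by simp
  qed
  have qc: "q n (c t) = q n t" for n t
    unfolding c_def by (rule periodic_add_int[where q = "q n"]) (rule per)
  define p where "p = (\<lambda>t. g (c t))"
  have lim: "(\<lambda>n. q (k n) t) \<longlonglongrightarrow> p t" for t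
  proof -
    have "(\<lambda>n. q (k n) (c t)) \<longlonglongrightarrow> g (c t)" unfolding LIMSEQ_iff using gk c by blast
    then show ?thesis by (simp add: p_def qc)
  qed
  have "p (t + T) = p t" for t using LIMSEQ_unique[OF lim[of "t + T"]] lim[of t] by (simp add: per)
  moreover have "1-lipschitz_on UNIV p"
  proof (rule lipschitz_onI)
    fix x y
    have "(\<lambda>n. q (k n) x - q (k n) y) \<longlonglongrightarrow> p x - p y" by (intro tendsto_intros lim)
    then have "norm (p x - p y) \<le> norm (x - y)" by (rule Lim_norm_ubound[rotated]) (use ql in auto)
    then show "dist (p x) (p y) \<le> 1 * dist x y" by (simp add: dist_norm)
  qed simp
  ultimately have "p \<in> Ksp T" by (auto simp: Ksp_def Wsp_def)
  then show thesis using that[OF k _ lim] by blast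
qed

text \<open>If the limit hits \<open>S\<close> at time \<open>t0\<close>, then \<open>q n\<close>
  lies within \<open>s - t0 + \<delta> n\<close> of the contact point at times \<open>s\<close> just
  after \<open>t0\<close>. Integrating the resulting lower bound on \<open>- P\<close> gives a
  logarithm that exceeds every constant as \<open>\<delta> n\<close> tends to 0, against the bound
  \<open>C\<close>.\<close>

lemma limit_avoids_singular_set:
  assumes T: "T > 0" and S: "compact S" and P: "classP T S P"
    and q: "\<And>n. q n \<in> KLam T S" and p: "p \<in> Ksp T" and lim: "\<And>t. (\<lambda>n. q n t) \<longlonglongrightarrow> p t"
    and int: "\<And>n. (\<lambda>t. - P t (q n t)) integrable_on {0..T}"
    and C: "\<And>n. integral {0..T} (\<lambda>t. - P t (q n t)) \<le> C"
  shows "p t \<notin> S"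
proof
  assume "p t \<in> S"
  have lip: "1-lipschitz_on UNIV (q n)" and qS: "q n t \<notin> S" for n t
    using q[of n] by (auto simp: KLam_def Ksp_def Lam_def)
  have per: "p (t + T) = p t" for t using p by (auto simp: Ksp_def Wsp_def)
  \<comment> \<open>Reduction into the half-open period leaves room for an interval
    \<open>{t0..t0 + \<eta>}\<close> inside \<open>{0..T}\<close>.\<close>
  define t0 where "t0 = t + of_int (- \<lfloor>t / T\<rfloor>) * T"
  have t0: "0 \<le> t0" "t0 < T" using mod_period_in_interval[OF T, of t] unfolding t0_def by auto
  have "p t0 = p t" unfolding t0_def by (rule periodic_add_int[of p, OF per])
  with \<open>p t \<in> S\<close> have p0: "p t0 \<in> S" by simp
  have "p t0 \<in> closure (- S)" 
    unfolding closure_sequential by (rule exI[of _ "\<lambda>n. q n t0"]) (simp add: lim qS)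
  then have "p t0 \<in> frontier S" using p0 closure_subset[of S] by (auto simp: frontier_closures)
  moreover have "S \<noteq> {}" "t0 \<in> {0..T}" using p0 t0 by auto
  ultimately have "\<exists>\<epsilon>>0. \<exists>r>0. \<forall>t x. x \<notin> S \<and> dist x (p t0) < \<epsilon> \<and> \<bar>t - t0\<bar> < \<epsilon> \<longrightarrow>
      - P t x \<ge> r / norm (x - p t0)"
    using P unfolding classP_def by blast
  then obtain \<epsilon> r where er: "\<epsilon> > 0" "r > 0" and sing: "\<And>t x. \<lbrakk>x \<notin> S; dist x (p t0) < \<epsilon>; \<bar>t - t0\<bar> < \<epsilon>\<rbrakk>
       \<Longrightarrow> - P t x \<ge> r / norm (x - p t0)"
    by blast
  obtain M0 where M0: "\<And>t x. x \<notin> S \<Longrightarrow> P t x \<le> M0" using P by (auto simp: classP_def)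
  \<comment> \<open>The shift makes \<open>- P + M\<close> nonnegative, so its integral over the
    short interval is at most that over the period. Taking the maximum with 0 preserves the singular
    lower bound under the shift.\<close>
  define M where "M = max M0 0"
  have M: "M \<ge> 0" "\<And>t x. x \<notin> S \<Longrightarrow> P t x \<le> M" using M0 by (auto simp: M_def le_max_iff_disj)
  define \<eta> where "\<eta> = min (\<epsilon> / 2) (T - t0)"
  have \<eta>: "0 < \<eta>" "\<eta> \<le> \<epsilon> / 2" "t0 + \<eta> \<le> T"
    using er t0 unfolding \<eta>_def by linarith+
  define \<delta> where "\<delta> = (\<lambda>n. norm (q n t0 - p t0))"
  have \<delta>0: "\<delta> n > 0" for n using qS[of n t0] p0 by (auto simp: \<delta>_def)
  have log_bound: "r * (ln \<eta> - ln (\<delta> n)) \<le> C + M * T" if \<delta>: "\<delta> n < \<epsilon> / 2" for n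
  proof -
    let ?I = "{t0..t0 + \<eta>}"
    let ?g = "\<lambda>s. r / (s - t0 + \<delta> n)"
    have "((\<lambda>s. r * ln (s - t0 + \<delta> n)) has_vector_derivative ?g s) (at s within ?I)" if "s \<in> ?I" for s
      using that \<delta>0[of n] unfolding has_real_derivative_iff_has_vector_derivative[symmetric]
      by (auto intro!: derivative_eq_intros)
    then have g: "(?g has_integral (r * ln (t0 + \<eta> - t0 + \<delta> n) - r * ln (t0 - t0 + \<delta> n))) ?I"
      using \<eta> by (intro fundamental_theorem_of_calculus) auto
    have PM: "(\<lambda>s. - P s (q n s) + M) integrable_on {0..T}"
      by (intro integrable_add int integrable_const_ivl)
    have PMI: "(\<lambda>s. - P s (q n s) + M) integrable_on ?I"
      by (rule integrable_on_subinterval[OF PM]) (use t0 \<eta> in auto)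
    have "?g s \<le> - P s (q n s) + M" if s: "s \<in> ?I" for s
    proof -
      have "norm (q n s - p t0) \<le> norm (q n s - q n t0) + \<delta> n"
        unfolding \<delta>_def using norm_triangle_ineq[of "q n s - q n t0" "q n t0 - p t0"] by simp
      also have "norm (q n s - q n t0) \<le> s - t0"
        using lipschitz_onD[OF lip[of n], of s t0] s by (simp add: dist_norm)
      finally have near: "norm (q n s - p t0) \<le> s - t0 + \<delta> n" by simp
      moreover have "s - t0 + \<delta> n < \<epsilon>" "\<bar>s - t0\<bar> < \<epsilon>" using s \<delta> \<eta> er by auto
      ultimately have *: "r / norm (q n s - p t0) \<le> - P s (q n s)"
        by (intro sing qS) (auto simp: dist_norm)
      have "0 < norm (q n s - p t0)" using qS[of n s] p0 by auto
      moreover from this near have "0 < s - t0 + \<delta> n" by linarith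
      ultimately have "?g s \<le> r / norm (q n s - p t0)"
        using near er by (intro divide_left_mono mult_pos_pos) simp_all
      then show ?thesis using * M(1) by linarith
    qed
    from has_integral_le[OF g integrable_integral[OF PMI] this]
    have "r * (ln (\<eta> + \<delta> n) - ln (\<delta> n)) \<le> integral ?I (\<lambda>s. - P s (q n s) + M)"
      by (simp add: right_diff_distrib)
    also have "\<dots> \<le> integral {0..T} (\<lambda>s. - P s (q n s) + M)"
      using M(2) qS t0 \<eta> by (intro integral_subset_le PM PMI) auto
    also have "\<dots> = integral {0..T} (\<lambda>s. - P s (q n s)) + integral {0..T} (\<lambda>s. M)"
      by (intro Henstock_Kurzweil_Integration.integral_add int integrable_const_ivl)
    also have "\<dots> \<le> C + M * T" using C[of n] T by simp
    finally have "r * (ln (\<eta> + \<delta> n) - ln (\<delta> n)) \<le> C + M * T" .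
    moreover have "r * (ln \<eta> - ln (\<delta> n)) \<le> r * (ln (\<eta> + \<delta> n) - ln (\<delta> n))"
      using \<delta>0[of n] \<eta> er by (intro mult_left_mono) auto
    ultimately show ?thesis by linarith
  qed
  \<comment> \<open>Below the second entry \<open>r * (ln \<eta> - ln (\<delta> n))\<close> exceeds
    \<open>C + M * T\<close>; the first entry keeps the singular estimate applicable.\<close>
  define m where "m = min (\<epsilon> / 2) (exp (ln \<eta> - (C + M * T) / r))"
  have "m > 0" using er by (simp add: m_def)
  moreover have "\<delta> \<longlonglongrightarrow> 0"
    unfolding \<delta>_def using tendsto_norm[OF tendsto_diff[OF lim[of t0] tendsto_const[of "p t0"]]] by simp
  ultimately have "\<forall>\<^sub>F n in sequentially. \<delta> n < m" by (rule order_tendstoD(2)[rotated])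
  then obtain n where n: "\<delta> n < m" using eventually_happens'[OF sequentially_bot] by blast
  then have "ln \<eta> - ln (\<delta> n) \<le> (C + M * T) / r"
    using log_bound[of n] er by (simp add: m_def pos_le_divide_eq mult.commute)
  moreover have "ln (\<delta> n) < ln \<eta> - (C + M * T) / r"
  proof -
    have "\<delta> n < exp (ln \<eta> - (C + M * T) / r)" using n by (simp add: m_def)
    then have "ln (\<delta> n) < ln (exp (ln \<eta> - (C + M * T) / r))"
      using \<delta>0[of n] by (subst ln_less_cancel_iff) auto
    then show ?thesis by simp
  qed
  ultimately show False by linarith
qed

subsection \<open>Existence of the minimiser\<close>

lemma action_split:
  assumes "C1_R4 A" "1-lipschitz_on UNIV q" "(\<lambda>t. - P t (q t)) integrable_on {0..T}"
  shows "action T A P q = kinetic T q + magnetic T A q + integral {0..T} (\<lambda>t. - P t (q t))"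
  using Henstock_Kurzweil_Integration.integral_add[OF magnetic_integrable[OF assms(1,2)] assms(3)]
  by (simp add: action_def magnetic_def)

text \<open>If the integrand is not integrable, its Henstock integral is the junk value 0 and only the
  nonnegative kinetic term remains.\<close>
lemma action_neg_imp_integrable:
  assumes "C1_R4 A" "1-lipschitz_on UNIV q" "action T A P q < 0"
  shows "(\<lambda>t. - P t (q t)) integrable_on {0..T}"
proof -
  have "(\<lambda>t. vector_derivative q (at t) \<bullet> A t (q t) - P t (q t)) integrable_on {0..T}"
  proof (rule ccontr)
    assume "\<not> ?thesis"
    then have "action T A P q = kinetic T q" by (simp add: action_def not_integrable_integral)
    then show False using assms(3) kinetic_nonneg[of T q] by simp
  qed
  from integrable_diff[OF this magnetic_integrable[OF assms(1,2)]] show ?thesis by simp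
qed

lemma action_const: "action T A P (\<lambda>t. x) = - varphi T P x"
  by (simp add: action_def kinetic_def varphi_def)

theorem mainTheorem10:
  fixes T :: real and S :: "vec3 set"
    and A :: "real \<Rightarrow> vec3 \<Rightarrow> vec3" and P :: "real \<Rightarrow> vec3 \<Rightarrow> real"
  assumes "T > 0" and "compact S"
    and "classAP T S A P"
    and "(INF q\<in>Lam T S. Ifun T S A P q) < 0"
  shows "\<exists>q\<in>KLam T S. (\<exists>s t. q s \<noteq> q t)
           \<and> Ifun T S A P q = (INF p\<in>Lam T S. Ifun T S A P p)"
proof -
  note T = assms(1) and S = assms(2)
  have A: "classA T A" and P: "classP T S P" and nrm: "normalized T S P"
    using assms(3) by (auto simp: classAP_def)
  have A1: "C1_R4 A" using A by (simp add: classA_def)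
  define m where "m = (INF q\<in>Lam T S. Ifun T S A P q)"
  have "m < 0" using assms(4) by (simp add: m_def)
  \<comment> \<open>Over the empty set the infimum would be the top element, which is not
    negative.\<close>
  then have "Lam T S \<noteq> {}" by (auto simp: m_def top_ereal_def)
  then have "Ifun T S A P ` Lam T S \<noteq> {}" by simp
  from Inf_as_limit[OF this] obtain w where w: "\<And>n. w n \<in> Ifun T S A P ` Lam T S" and wlim: "w \<longlonglongrightarrow> m"
    unfolding m_def by blast
  from w have "\<forall>n. \<exists>q. q \<in> Lam T S \<and> w n = Ifun T S A P q" by blast
  then obtain q0 where q0: "\<And>n. w n = Ifun T S A P (q0 n)" by metis
  \<comment> \<open>A fixed level strictly between the infimum and 0. Late members of the sequence
    lie below it, so coercivity with error \<open>- c0\<close> bounds their starting points, and the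
    finite value places them in \<open>KLam\<close>.\<close>
  obtain c0 where c0: "m < ereal c0" "ereal c0 < 0" using ereal_dense2[OF \<open>m < 0\<close>] by blast
  then have "0 < - c0" by simp
  then obtain R where R: "\<And>q. \<lbrakk>q \<in> KLam T S; R \<le> norm (q 0)\<rbrakk> \<Longrightarrow> - (- c0) \<le> action T A P q"
    by (rule action_coercive[OF T S A P nrm]) blast
  obtain n0 where n0: "\<And>n. n \<ge> n0 \<Longrightarrow> w n < ereal c0"
    using order_tendstoD(2)[OF wlim c0(1)] by (auto simp: eventually_sequentially)
  define q1 where "q1 = (\<lambda>n. q0 (n + n0))"
  have q1: "q1 n \<in> KLam T S" "action T A P (q1 n) < c0" for n
  proof -
    have "Ifun T S A P (q1 n) < ereal c0" using n0[of "n + n0"] q0 by (simp add: q1_def)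
    then show "q1 n \<in> KLam T S" by (auto simp: Ifun_def split: if_splits)
    then show "action T A P (q1 n) < c0" using \<open>Ifun T S A P (q1 n) < ereal c0\<close> by (simp add: Ifun_eq_action)
  qed
  have q1lim: "(\<lambda>n. ereal (action T A P (q1 n))) \<longlonglongrightarrow> m"
  proof -
    have "(\<lambda>n. w (n + n0)) \<longlonglongrightarrow> m" using wlim by (rule LIMSEQ_ignore_initial_segment)
    then show ?thesis unfolding q0 using Ifun_eq_action[OF q1(1)] by (simp add: q1_def)
  qed
  have "norm (q1 n 0) \<le> R" for n
    using R[OF q1(1)[of n]] q1(2)[of n] by fastforce
  moreover have "q1 n \<in> Ksp T" for n using q1(1)[of n] by (simp add: KLam_def)
  ultimately obtain k1 p where k1: "strict_mono (k1 :: nat \<Rightarrow> nat)" and p: "p \<in> Ksp T"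
    and lim1: "\<And>t. (\<lambda>n. q1 (k1 n) t) \<longlonglongrightarrow> p t"
    using Ksp_bounded_subsequence[OF T, of q1 R] by metis
  have plip: "1-lipschitz_on UNIV p" using p by (simp add: Ksp_def)
  have lip1: "1-lipschitz_on UNIV (q1 n)" and q1S: "q1 n t \<notin> S" for n t
    using q1(1)[of n] by (auto simp: KLam_def Ksp_def Lam_def)
  have bd: "norm (q1 (k1 n) t) \<le> R + T" if "t \<in> {0..T}" for n t
    using lipschitz_onD[OF lip1[of "k1 n"], of t 0] \<open>norm (q1 (k1 n) 0) \<le> R\<close> that
      norm_triangle_ineq2[of "q1 (k1 n) t" "q1 (k1 n) 0"] by (simp add: dist_norm)
  obtain k2 l where k2: "strict_mono (k2 :: nat \<Rightarrow> nat)"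
    and alim: "(\<lambda>n. kinetic T (q1 (k1 (k2 n))) + magnetic T A (q1 (k1 (k2 n)))) \<longlonglongrightarrow> l"
    and pl: "kinetic T p + magnetic T A p \<le> l"
    by (rule action_lower_semicontinuous[OF T A1 lip1[of "k1 _"] plip lim1 bd]) blast
  define q where "q = (\<lambda>n. q1 (k1 (k2 n)))"
  define a where "a = (\<lambda>n. kinetic T (q n) + magnetic T A (q n))"
  have a: "a \<longlonglongrightarrow> l" using alim by (simp add: a_def q_def)
  have qK: "q n \<in> KLam T S" and qlip: "1-lipschitz_on UNIV (q n)" and qS: "q n t \<notin> S"
    and qneg: "action T A P (q n) < c0" for n t
    by (simp_all add: q_def q1 lip1 q1S)
  have qlim: "(\<lambda>n. q n t) \<longlonglongrightarrow> p t" for t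
    using LIMSEQ_subseq_LIMSEQ[OF lim1[of t] k2] by (simp add: o_def q_def)
  have actlim: "(\<lambda>n. ereal (action T A P (q n))) \<longlonglongrightarrow> m"
    using LIMSEQ_subseq_LIMSEQ[OF q1lim strict_mono_o[OF k1 k2]] by (simp add: o_def q_def)
  \<comment> \<open>Negativity of the action excludes the default value of a non-integrable
    integrand, so the potential term can be separated.\<close>
  have Pint: "(\<lambda>t. - P t (q n t)) integrable_on {0..T}" for n
    using qneg[of n] \<open>0 < - c0\<close> by (intro action_neg_imp_integrable[OF A1 qlip]) simp
  have split: "action T A P (q n) = a n + integral {0..T} (\<lambda>t. - P t (q n t))" for n
    using action_split[where P = P and T = T, OF A1 qlip Pint] by (simp add: a_def)
  \<comment> \<open>The kinetic and magnetic parts converge, hence are bounded; as the actions lie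
    below \<open>c0\<close>, the potential integrals are bounded above, which keeps the limit off
    \<open>S\<close>.\<close>
  have "Bseq a" using a by (auto intro: convergent_imp_Bseq convergentI)
  then obtain B where B: "\<And>n. norm (a n) \<le> B" unfolding Bseq_def by blast
  have "integral {0..T} (\<lambda>t. - P t (q n t)) \<le> c0 + B" for n
    using split[of n] qneg[of n] B[of n] by (simp add: abs_le_iff)
  then have pS: "p t \<notin> S" for t
    by (rule limit_avoids_singular_set[OF T S P qK p qlim Pint])
  have pK: "p \<in> KLam T S" and pL: "p \<in> Lam T S"
    using p pS by (auto simp: KLam_def Lam_def Ksp_def)
  obtain M where M: "\<And>t x. x \<notin> S \<Longrightarrow> P t x \<le> M" using P by (auto simp: classP_def)
  have Plim: "(\<lambda>n. - P t (q n t)) \<longlonglongrightarrow> - P t (p t)" for t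
  proof -
    have "P t differentiable (at (p t))" using P pS by (auto simp: classP_def)
    then have "isCont (P t) (p t)" by (rule differentiable_imp_continuous_within)
    from tendsto_minus[OF isCont_tendsto_compose[OF this qlim[of t]]] show ?thesis .
  qed
  \<comment> \<open>At this stage the extended real \<open>m\<close> might still be minus infinity,
    so the limit is compared with an arbitrary real \<open>d\<close> above it. The slack
    \<open>e\<close> absorbs the deviation of \<open>a n\<close> from its limit \<open>l\<close>
    before Fatou's lemma is applied.\<close>
  have sub: "action T A P p \<le> d + e" if d: "m < ereal d" and e: "e > 0" for d e
  proof -
    have "\<forall>\<^sub>F n in sequentially. ereal (action T A P (q n)) < ereal d"
      using actlim d by (rule order_tendstoD)
    moreover have "\<forall>\<^sub>F n in sequentially. l - e < a n"
      using a e by (intro order_tendstoD) auto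
    ultimately have "\<forall>\<^sub>F n in sequentially. integral {0..T} (\<lambda>t. - P t (q n t)) \<le> d - l + e"
      by eventually_elim (simp add: split)
    then obtain n1 where n1: "\<And>n. integral {0..T} (\<lambda>t. - P t (q (n + n1) t)) \<le> d - l + e"
      unfolding eventually_sequentially by (metis le_add2)
    have "- M \<le> - P t (q (n + n1) t)" for n t using M[OF qS[of "n + n1" t]] by simp
    note F = Fatou_integral_le[where f = "\<lambda>n t. - P t (q (n + n1) t)" and M = M, OF Pint this
        LIMSEQ_ignore_initial_segment[OF Plim] n1]
    have "(\<lambda>t. - P t (p t)) integrable_on {0..T}" "integral {0..T} (\<lambda>t. - P t (p t)) \<le> d - l + e"
      by (rule F)+
    then show ?thesis using action_split[OF A1 plip, of P T] pl by simp
  qed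
  have le: "Ifun T S A P p \<le> m"
  proof (rule ccontr)
    assume "\<not> Ifun T S A P p \<le> m"
    then have "m < ereal (action T A P p)" by (simp add: Ifun_eq_action[OF pK] not_le)
    then obtain d where d: "m < ereal d" "ereal d < ereal (action T A P p)" using ereal_dense2 by blast
    then show False using sub[OF d(1), of "(action T A P p - d) / 2"] by (simp add: field_simps)
  qed
  moreover have "m \<le> Ifun T S A P p" unfolding m_def by (rule INF_lower[OF pL])
  ultimately have eq: "Ifun T S A P p = m" by (rule antisym)
  have "\<exists>s t. p s \<noteq> p t"
  proof (rule ccontr)
    assume "\<nexists>s t. p s \<noteq> p t"
    then have "p = (\<lambda>t. p 0)" by (intro ext) metis
    then have "action T A P p = - varphi T P (p 0)" by (metis action_const)
    then have "0 \<le> action T A P p" using varphi_nonpos[OF T P nrm pS] by simp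
    moreover have "Ifun T S A P p < 0" using eq \<open>m < 0\<close> by simp
    ultimately show False by (simp add: Ifun_eq_action[OF pK])
  qed
  with pK eq show ?thesis unfolding m_def by blast
qed

end
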